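(* Let $K=\mathbb{Q}(t)$, let $d>0$ and $s\ge2$ be integers, and let \[r_d=\begin{cases}(1/2)^{d/2+1}& d\text{ even},\\ (1/2)^{(d+1)/2}& d\text{ odd}.\end{cases}\] For each $S$ let $\nu_S$ be a strictly positive probability measure on $S$ and $\bar\nu_S=\nu_S^{\mathbb{N}}$. Then: (1) If $d$ is even, \[\liminf_{B\to\infty}\frac{\#\{S\in\mathcal{S}(d,s,B): \bar\nu_S(\mathrm{BigArb}(S,K))>0\}}{\#\mathcal{S}(d,s,B)}\ge 1-(1-r_d)^s.\] (2) If $d$ is odd, \[\liminf_{B\to\infty}\frac{\#\{S\in\mathcal{S}(d,s,B): \bar\nu_S(\mathrm{BigArb}(S,K))>0\}}{\#\mathcal{S}(d,s,B)}\ge 1-(1-r_d)^s-\Big(\tfrac12\Big)^s+\Big(1-r_d-\tfrac12\Big)^s.\]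
   Context: For $f=a_dt^d+\dots+a_0\in\mathbb{Z}[t]$ let $|f|=\max_i|a_i|$ and $P_d(B)=\{f\in\mathbb{Z}[t]:\deg f\le d,\ |f|\le B\}$. Let $\mathcal{S}(d,s,B)$ be the collection of $s$-element subsets $\{c_1,\dots,c_s\}$ of $P_d(B)$; each such subset is identified with the set $S=\{x^2+c_1,\dots,x^2+c_s\}$ of quadratic polynomials over $\mathbb{Z}[t]\subset K$. A probability measure on $S$ is strictly positive if every element has positive mass. For $\gamma=(\theta_n)_{n\ge1}\in\Phi_S=S^{\mathbb{N}}$ let $\gamma_n=\theta_1\circ\cdots\circ\theta_n$, let $K_n(\gamma)$ be the splitting field of $\gamma_n$ over $K$ (with $K_0(\gamma)=K$). $\gamma$ is stable over $K$ if $\gamma_n$ is irreducible in $K[x]$ for all $n\ge1$; $K_n(\gamma)/K_{n-1}(\gamma)$ is maximal if $[K_n(\gamma):K_{n-1}(\gamma)]=2^{2^{n-1}}$. $\mathrm{BigArb}(S,K)$ is the set of $\gamma\in\Phi_S$ that are stable over $K$ and for which $K_n(\gamma)/K_{n-1}(\gamma)$ is maximal for infinitely many $n$. *)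

theory Defs
  imports
    "HOL-Probability.Probability"
    "HOL-Algebra.Algebra"
    "HOL-Algebra.Algebraic_Closure_Type"
    "HOL-Computational_Algebra.Computational_Algebra"
begin

type_synonym Qt = "rat poly fract"

text \<open>
  The polynomials x^2 + c with c in Z[t] have type \<^typ>\<open>int poly poly\<close>: the outer variable is x,
  the inner one is t.
\<close>

definition to_K :: "int poly \<Rightarrow> Qt"
  where "to_K c = to_fract (map_poly of_int c)"

definition poly_to_K :: "int poly poly \<Rightarrow> Qt poly"
  where "poly_to_K f = map_poly to_K f"

definition height :: "int poly \<Rightarrow> int"
  where "height f = Max ((\<lambda>i. \<bar>Polynomial.coeff f i\<bar>) ` {..Polynomial.degree f})"

definition bounded_polys :: "nat \<Rightarrow> nat \<Rightarrow> int poly set"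
  where "bounded_polys d B = {f. Polynomial.degree f \<le> d \<and> height f \<le> int B}"

definition quad :: "int poly \<Rightarrow> int poly poly"
  where "quad c = [:c, 0, 1:]"

text \<open>
  Each set of constants \<open>C\<close> is represented by the set \<open>quad ` C\<close> of quadratic polynomials; since
  \<^const>\<open>quad\<close> is injective, this does not affect the counting.
\<close>

definition quad_sets :: "nat \<Rightarrow> nat \<Rightarrow> nat \<Rightarrow> int poly poly set set"
  where "quad_sets d s B = {quad ` C | C. C \<subseteq> bounded_polys d B \<and> card C = s}"

definition strictly_positive_prob :: "'a set \<Rightarrow> 'a measure \<Rightarrow> bool"
  where "strictly_positive_prob S M \<longleftrightarrow>
    prob_space M \<and> space M = S \<and> sets M = Pow S \<and> (\<forall>f\<in>S. measure M {f} > 0)"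

text \<open>
  Sequences \<open>(\<theta>\<^sub>n)\<close>, \<open>n \<ge> 1\<close>, are extensional functions on \<open>{1..}\<close>, so that \<open>\<Phi>\<^sub>S\<close> is the underlying
  space of the product measure.
\<close>

definition seq_space :: "'a set \<Rightarrow> (nat \<Rightarrow> 'a) set"
  where "seq_space S = PiE {1..} (\<lambda>_. S)"

definition seq_measure :: "'a measure \<Rightarrow> (nat \<Rightarrow> 'a) measure"
  where "seq_measure M = PiM {1..} (\<lambda>_. M)"

primrec iter_comp :: "(nat \<Rightarrow> 'a::comm_semiring_1 poly) \<Rightarrow> nat \<Rightarrow> 'a poly"
  where
    "iter_comp \<gamma> 0 = [:0, 1:]"
  | "iter_comp \<gamma> (Suc n) = pcompose (iter_comp \<gamma> n) (\<gamma> (Suc n))"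

definition splitting_field :: "'k::field poly \<Rightarrow> 'k alg_closure set"
  where "splitting_field f =
    generate_field ring_of_type_algebra
      (range to_ac \<union> {\<alpha>. poly (map_poly to_ac f) \<alpha> = 0})"

text \<open>
  The polynomial \<open>iter_comp \<gamma> 0 = x\<close> has only the root 0, so \<open>K_iter \<gamma> 0\<close> is (the image of) the
  ground field.
\<close>

definition K_iter :: "(nat \<Rightarrow> int poly poly) \<Rightarrow> nat \<Rightarrow> Qt alg_closure set"
  where "K_iter \<gamma> n = splitting_field (poly_to_K (iter_comp \<gamma> n))"

definition stable_over_K :: "(nat \<Rightarrow> int poly poly) \<Rightarrow> bool"
  where "stable_over_K \<gamma> \<longleftrightarrow> (\<forall>n\<ge>1. Factorial_Ring.irreducible (poly_to_K (iter_comp \<gamma> n)))"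

definition maximal_step :: "(nat \<Rightarrow> int poly poly) \<Rightarrow> nat \<Rightarrow> bool"
  where "maximal_step \<gamma> n \<longleftrightarrow>
    ring.dimension ring_of_type_algebra (2 ^ (2 ^ (n - 1))) (K_iter \<gamma> (n - 1)) (K_iter \<gamma> n)"

definition BigArb :: "int poly poly set \<Rightarrow> (nat \<Rightarrow> int poly poly) set"
  where "BigArb S = {\<gamma> \<in> seq_space S. stable_over_K \<gamma> \<and> infinite {n. n \<ge> 1 \<and> maximal_step \<gamma> n}}"

definition r_dens :: "nat \<Rightarrow> real"
  where "r_dens d = (if even d then (1/2) ^ (d div 2 + 1) else (1/2) ^ ((d + 1) div 2))"

end

theory Submission
  imports Defs "HOL-Library.Z2"
begin

text \<open>
  Write \<open>\<gamma>\<^sub>n\<close> for \<open>\<theta>\<^sub>1 \<circ> \<dots> \<circ> \<theta>\<^sub>n\<close> with \<open>\<theta>\<^sub>i = x\<^sup>2 + c\<^sub>i\<close>. Suppose that \<open>c\<^sub>1' \<equiv> 1\<close> modulo 2. Then every \<open>\<gamma>\<^sub>n\<close>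
  is irreducible: modulo \<open>(2, t)\<close> it is \<open>(x - e)\<^bsup>2^n\<^esup>\<close>, while the coefficient of \<open>t\<close> in \<open>\<gamma>\<^sub>n(e)\<close> is odd,
  so an Eisenstein argument applies. If moreover \<open>c\<^sub>n\<close> has an odd coefficient at \<open>t\<^sup>d\<close>, then
  \<open>\<gamma>\<^sub>n(0)\<close> has odd leading coefficient, degree \<open>d 2\<^bsup>n-1\<^esup>\<close>, and derivative \<open>\<equiv> 1\<close> modulo 2, hence it is
  squarefree; for degree reasons it has a simple complex root \<open>\<tau>\<close> at which no \<open>\<gamma>\<^sub>m(0)\<close>, \<open>m < n\<close>,
  vanishes. Expanding at \<open>\<tau>\<close> embeds \<open>K\<close> into the complex Laurent series, and
  for each root \<open>\<beta>\<close> of \<open>\<gamma>\<^bsub>n-1\<^esub>\<close> the embedding extends to \<open>K\<^bsub>n-1\<^esub>\<close> so that \<open>\<beta> - c\<^sub>n\<close> gets valuation 1, whereas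
  \<open>\<beta>' - c\<^sub>n\<close> becomes a unit, and thus a square, for every other root \<open>\<beta>'\<close>. Therefore \<open>\<surd>(\<beta> - c\<^sub>n)\<close> lies
  outside the field generated over \<open>K\<^bsub>n-1\<^esub>\<close> by all the other square roots, and the step is maximal.

  A sequence that starts with such a \<open>c\<^sub>1\<close> meets a given \<open>c\<^sub>n\<close> infinitely often almost
  surely, so it remains to count the sets that contain elements of both kinds. For even \<open>d\<close> one element can
  play both roles, which costs one parity condition more; for odd \<open>d > 1\<close> the two kinds are disjoint.
\<close>

hide_const (open) Polynomials.degree Polynomials.lead_coeff UnivPoly.coeff UnivPoly.monom Module.smult Coset.order Divisibility.irreducible Divisibility.prime

unbundle no vec_syntax

section \<open>Compositions of quadratic polynomials\<close>

text \<open>Evaluating the composition as a function, with \<open>\<theta>\<^sub>n\<close> applied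
  first, makes sense over any commutative ring, so one recursion serves \<open>Z[t]\<close>, power
  series and the algebraic closure of K.\<close>

primrec qval :: "(nat \<Rightarrow> 'a::comm_ring_1) \<Rightarrow> nat \<Rightarrow> 'a \<Rightarrow> 'a"
  where
    "qval c 0 x = x"
  | "qval c (Suc n) x = qval c n (x ^ 2 + c (Suc n))"

definition qpoly :: "(nat \<Rightarrow> 'a::comm_ring_1) \<Rightarrow> nat \<Rightarrow> 'a poly"
  where "qpoly c n = iter_comp (\<lambda>i. [:c i, 0, 1:]) n"

lemma qpoly_0 [simp]: "qpoly c 0 = [:0, 1:]"
  by (simp add: qpoly_def)

lemma qpoly_Suc [simp]: "qpoly c (Suc n) = pcompose (qpoly c n) [:c (Suc n), 0, 1:]"
  by (simp add: qpoly_def)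

lemma poly_qpoly: "poly (qpoly c n) x = qval c n x"
  by (induction n arbitrary: x) (simp_all add: poly_pcompose power2_eq_square add.commute)

lemma iter_comp_cong:
  "(\<And>i. 1 \<le> i \<Longrightarrow> i \<le> n \<Longrightarrow> f i = g i) \<Longrightarrow> iter_comp f n = iter_comp g n"
  by (induction n) auto

lemma iter_comp_eq_qpoly:
  assumes "\<And>i. 1 \<le> i \<Longrightarrow> i \<le> n \<Longrightarrow> \<gamma> i = quad (c i)"
  shows "iter_comp \<gamma> n = qpoly c n"
  unfolding qpoly_def by (rule iter_comp_cong) (auto simp: assms quad_def)

lemma degree_qpoly: "degree (qpoly c n) = 2 ^ n" for c :: "nat \<Rightarrow> 'a::idom"
  by (induction n) (auto simp: degree_pcompose)

lemma lead_coeff_qpoly: "lead_coeff (qpoly c n) = 1" for c :: "nat \<Rightarrow> 'a::idom"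
  by (induction n) (auto simp: lead_coeff_comp)

text \<open>Reduction modulo 2, Taylor expansion and the embeddings of K are all instances;
  \<open>map_poly_qpoly\<close> and \<open>qval_hom\<close> carry compositions along each of
  them.\<close>

locale ring_morphism =
  fixes h :: "'a::comm_ring_1 \<Rightarrow> 'b::comm_ring_1"
  assumes add: "h (x + y) = h x + h y"
    and mult: "h (x * y) = h x * h y"
    and one: "h 1 = 1"
begin

lemma zero: "h 0 = 0"
  using add[of 0 0] by simp

lemma uminus: "h (- x) = - h x"
  using add[of x "- x"] by (simp add: zero eq_neg_iff_add_eq_0 add.commute)

lemma diff: "h (x - y) = h x - h y"
  using add[of x "- y"] by (simp add: uminus)

lemma power: "h (x ^ n) = h x ^ n"
  by (induction n) (simp_all add: mult one)

lemma map_poly_add: "map_poly h (p + q) = map_poly h p + map_poly h q"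
  by (intro poly_eqI) (simp add: coeff_map_poly zero add)

lemma map_poly_diff: "map_poly h (p - q) = map_poly h p - map_poly h q"
  by (intro poly_eqI) (simp add: coeff_map_poly zero diff)

lemma map_poly_mult: "map_poly h (p * q) = map_poly h p * map_poly h q"
proof (induction p)
  case (pCons a p)
  have "map_poly h (pCons a p * q) = map_poly h (smult a q) + map_poly h (pCons 0 (p * q))"
    by (simp add: map_poly_add)
  also have "\<dots> = map_poly h (pCons a p) * map_poly h q"
    using pCons.IH by (simp add: map_poly_smult map_poly_pCons zero mult)
  finally show ?case .
qed simp

lemma map_poly_pcompose: "map_poly h (pcompose p q) = pcompose (map_poly h p) (map_poly h q)"
  by (induction p) (simp_all add: pcompose_pCons map_poly_add map_poly_mult map_poly_pCons zero)

lemma poly_map_poly: "poly (map_poly h p) (h x) = h (poly p x)"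
  by (induction p) (simp_all add: map_poly_pCons zero add mult)

lemma map_poly_hom: "ring_morphism (map_poly h)"
  by standard (simp_all add: map_poly_add map_poly_mult one)

lemma map_poly_qpoly: "map_poly h (qpoly c n) = qpoly (\<lambda>i. h (c i)) n"
  by (induction n) (simp_all add: map_poly_pcompose map_poly_pCons zero one)

lemma qval_hom: "h (qval c n x) = qval (\<lambda>i. h (c i)) n (h x)"
  by (induction n arbitrary: x) (simp_all add: add power)

lemma comp: "ring_morphism g \<Longrightarrow> ring_morphism (\<lambda>x. g (h x))"
  by (auto simp: ring_morphism_def add mult one)

end

section \<open>Concrete morphisms and their extension to fraction fields\<close>

lemma ring_morphism_of_int: "ring_morphism (of_int :: int \<Rightarrow> 'a::comm_ring_1)"
  by standard auto

lemma ring_morphism_of_rat: "ring_morphism (of_rat :: rat \<Rightarrow> 'a::field_char_0)"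
  by standard (auto simp: of_rat_add of_rat_mult)

lemma ring_morphism_to_fract: "ring_morphism (to_fract :: 'a::idom \<Rightarrow> 'a fract)"
  by standard auto

lemma ring_morphism_to_ac: "ring_morphism (to_ac :: 'a::field \<Rightarrow> 'a alg_closure)"
  by standard auto

lemma ring_morphism_to_K: "ring_morphism to_K"
proof -
  interpret i: ring_morphism "of_int :: int \<Rightarrow> rat" by (rule ring_morphism_of_int)
  show ?thesis
    unfolding to_K_def using ring_morphism.comp[OF i.map_poly_hom ring_morphism_to_fract] .
qed

lemma map_poly_of_int_eq_0_iff: "map_poly of_int p = (0 :: 'a::{comm_ring_1,ring_char_0} poly) \<longleftrightarrow> p = 0"
  by (auto simp: poly_eq_iff coeff_map_poly)

lemma to_K_eq_0_iff [simp]: "to_K p = 0 \<longleftrightarrow> p = 0"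
  by (simp add: to_K_def map_poly_of_int_eq_0_iff)

text \<open>The value is read off from the normalized fraction; \<open>fract_lift_Fract\<close>
  shows that for an injective morphism every other representative gives the same value.\<close>

definition fract_lift :: "('a::{ring_gcd,idom_divide,semiring_gcd_mult_normalize} \<Rightarrow> 'b::field) \<Rightarrow> 'a fract \<Rightarrow> 'b"
  where "fract_lift h x = h (fst (quot_of_fract x)) / h (snd (quot_of_fract x))"

lemma fract_lift_Fract:
  assumes "ring_morphism h" and "\<And>x. h x = 0 \<Longrightarrow> x = 0" and "b \<noteq> 0"
  shows "fract_lift h (Fract a b) = h a / h b"
proof -
  interpret h: ring_morphism h by fact
  define a' b' where "a' = fst (quot_of_fract (Fract a b))" and "b' = snd (quot_of_fract (Fract a b))"
  have b': "b' \<noteq> 0" by (simp add: b'_def)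
  have "Fract a' b' = Fract a b" by (simp add: a'_def b'_def)
  then have "a' * b = a * b'" using b' assms(3) by (simp add: eq_fract)
  then have "h a' * h b = h a * h b'" by (metis h.mult)
  moreover have "h b \<noteq> 0" "h b' \<noteq> 0" using b' assms(2,3) by auto
  ultimately show ?thesis
    unfolding fract_lift_def a'_def[symmetric] b'_def[symmetric] by (simp add: frac_eq_eq)
qed

lemma fract_lift_hom:
  assumes "ring_morphism h" and inj: "\<And>x. h x = 0 \<Longrightarrow> x = 0"
  shows "ring_morphism (fract_lift h)"
proof -
  interpret ring_morphism h by fact
  note F = fract_lift_Fract[OF assms]
  show ?thesis
  proof
    fix x y :: "'a fract"
    obtain a b where x: "x = Fract a b" "b \<noteq> 0" by (cases x) auto
    obtain c d where y: "y = Fract c d" "d \<noteq> 0" by (cases y) auto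
    have nz: "h b \<noteq> 0" "h d \<noteq> 0" using x y inj by auto
    show "fract_lift h (x + y) = fract_lift h x + fract_lift h y"
      using x y nz by (simp add: F add mult field_simps)
    show "fract_lift h (x * y) = fract_lift h x * fract_lift h y"
      using x y nz by (simp add: F mult field_simps)
  next
    show "fract_lift h 1 = 1"
      using F[of 1 1] by (simp add: One_fract_def one)
  qed
qed

lemma fract_lift_to_fract:
  assumes "ring_morphism h" and "\<And>x. h x = 0 \<Longrightarrow> x = 0"
  shows "fract_lift h (to_fract a) = h a"
  unfolding to_fract_def using fract_lift_Fract[OF assms, of 1 a] assms(1) by (simp add: ring_morphism.one)

section \<open>Irreducibility\<close>

lemma of_int_bit: "(of_int n :: bit) = of_bool (odd n)"
proof (cases "even n")
  case True
  then obtain k where "n = 2 * k" by (elim evenE)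
  then show ?thesis by simp
next
  case False
  then obtain k where "n = 2 * k + 1" by (elim oddE)
  then show ?thesis by simp
qed

text \<open>The order of \<open>h\<close> at \<open>e\<close> is at most its degree, which is less
  than \<open>N\<close>; as the orders of both factors add up to \<open>N\<close>, that of
  \<open>g\<close> is positive.\<close>

lemma dvd_linear_power_root:
  fixes g :: "'a::idom poly"
  assumes "g * h = [:-e, 1:] ^ N" and "degree g > 0"
  shows "poly g e = 0"
proof (rule ccontr)
  assume "poly g e \<noteq> 0"
  then have "order e g = 0" by (rule order_0I)
  have nz: "g * h \<noteq> 0" unfolding assms(1) by simp
  then have "order e g + order e h = N"
    using order_mult[OF nz, of e] by (simp add: assms(1) order_power_n_n)
  with \<open>order e g = 0\<close> have "N \<le> degree h"
    using nz order_degree[of h e] by auto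
  moreover have "degree g + degree h = N"
    using arg_cong[OF assms(1), of degree] nz by (simp add: degree_mult_eq degree_power_eq)
  ultimately show False using assms(2) by simp
qed

lemma pcompose_power: "pcompose (p ^ k) q = pcompose p q ^ k" for p q :: "'a::comm_semiring_1 poly"
  by (induction k) (simp_all add: pcompose_1 pcompose_mult)

text \<open>In characteristic 2, with every scalar equal to its own square,
  \<open>x ^ 2 + c - e\<close> is the square of \<open>x - (e - c)\<close>.\<close>

lemma qpoly_bit: "\<exists>e. qpoly (c :: nat \<Rightarrow> bit) n = [:- e, 1:] ^ (2 ^ n)"
proof (induction n)
  case 0
  show ?case by (intro exI[of _ 0]) simp
next
  case (Suc n)
  then obtain e where e: "qpoly c n = [:- e, 1:] ^ (2 ^ n)" by blast
  define d where "d = e - c (Suc n)"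
  have "pcompose [:- e, 1:] [:c (Suc n), 0, 1:] = [:- d, 1:] ^ 2"
    by (cases e; cases "c (Suc n)") (simp_all add: d_def pcompose_pCons power2_eq_square)
  then have "qpoly c (Suc n) = [:- d, 1:] ^ (2 ^ Suc n)"
    by (simp add: e pcompose_power power_mult)
  then show ?case by blast
qed

text \<open>The defining recursion peels off the innermost map. Peeling off the outermost one
  exhibits each value as a square plus \<open>c 1\<close>, and modulo 2 a square has no coefficient
  at t and zero derivative.\<close>

lemma qval_Suc_left: "qval c (Suc n) x = (qval (\<lambda>i. c (Suc i)) n x) ^ 2 + c 1"
  by (induction n arbitrary: x) simp_all

lemma coeff_1_mult: "coeff (p * q) 1 = coeff p 0 * coeff q 1 + coeff p 1 * coeff q 0"
  by (simp add: coeff_mult)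

lemma odd_coeff_1_qval:
  fixes c :: "nat \<Rightarrow> int poly"
  assumes "odd (coeff (c 1) 1)" and "n \<ge> 1"
  shows "odd (coeff (qval c n x) 1)"
proof -
  from \<open>n \<ge> 1\<close> obtain m where "n = Suc m" by (cases n) auto
  with assms show ?thesis
    by (simp only: qval_Suc_left) (simp add: power2_eq_square coeff_1_mult[unfolded One_nat_def])
qed

text \<open>The reduction \<open>r\<close> below sends \<open>t\<close> to 0 and reduces modulo 2; both factors of a proper factorization
  would vanish at \<open>e\<close> under \<open>r\<close>, so the coefficient of \<open>t\<close> in their product would be even there.\<close>

lemma irreducible_qpoly_int:
  fixes c :: "nat \<Rightarrow> int poly"
  assumes "odd (coeff (c 1) 1)" and "n \<ge> 1"
  shows "irreducible (qpoly c n)"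
proof (rule Factorial_Ring.irreducibleI)
  show "qpoly c n \<noteq> 0"
    using degree_qpoly[of c n] by auto
  show "\<not> qpoly c n dvd 1"
    using degree_qpoly[of c n] using dvd_imp_degree_le[of "qpoly c n" 1] by auto
next
  fix g h assume gh: "qpoly c n = g * h"
  have lc: "lead_coeff g * lead_coeff h = 1"
    using lead_coeff_qpoly[of c n] by (simp add: gh lead_coeff_mult)
  define r where "r = (\<lambda>p. of_int (coeff p 0) :: bit)"
  interpret r: ring_morphism r
    by standard (simp_all add: r_def coeff_mult)
  obtain e where e: "qpoly (\<lambda>i. r (c i)) n = [:- e, 1:] ^ (2 ^ n)"
    using qpoly_bit by blast
  have prod: "map_poly r g * map_poly r h = [:- e, 1:] ^ (2 ^ n)"
    unfolding r.map_poly_mult[symmetric] gh[symmetric] r.map_poly_qpoly e ..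
  have "r (lead_coeff g) * r (lead_coeff h) = 1"
    by (metis lc r.mult r.one)
  then have nz: "r (lead_coeff g) \<noteq> 0" "r (lead_coeff h) \<noteq> 0" by auto
  \<comment> \<open>A lift of \<open>e\<close> to a constant integer polynomial, so that vanishing
    at \<open>e\<close> modulo \<open>(2, t)\<close> becomes evenness of the constant coefficient of
    the value at \<open>e'\<close>.\<close>
  define e' where "e' = [:if e = 0 then 0 else 1 :: int:]"
  have "r e' = e" by (simp add: e'_def r_def)
  have even: "even (coeff (poly q e') 0)" if "poly (map_poly r q) e = 0" for q
  proof -
    have "r (poly q e') = 0" using that r.poly_map_poly[of q e'] \<open>r e' = e\<close> by simp
    then show ?thesis by (simp add: r_def of_int_bit)
  qed
  have False if "degree g > 0" "degree h > 0"
  proof -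
    \<comment> \<open>The leading coefficients multiply to 1, so they survive the reduction and the
      degrees do not drop.\<close>
    have "degree (map_poly r g) > 0" "degree (map_poly r h) > 0"
      using that nz by (simp_all add: map_poly_degree_eq)
    then have "poly (map_poly r g) e = 0" "poly (map_poly r h) e = 0"
      using dvd_linear_power_root[OF prod] dvd_linear_power_root[of "map_poly r h" "map_poly r g"] prod
      by (simp_all add: mult.commute)
    then have "even (coeff (poly g e' * poly h e') 1)"
      unfolding coeff_1_mult using even by simp
    moreover have "poly g e' * poly h e' = qval c n e'"
      by (simp add: gh[symmetric] poly_qpoly flip: poly_mult)
    ultimately show False
      using odd_coeff_1_qval[of c n e'] assms by simp
  qed
  moreover have "p dvd 1" if "degree p = 0" "lead_coeff p * q = 1" for p :: "int poly poly" and q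
    using that by (metis dvd_triv_left is_unit_const_poly_iff degree_0_id dvdI)
  ultimately show "g dvd 1 \<or> h dvd 1"
    using lc by (metis mult.commute not_gr0)
qed

lemma irreducible_map_poly_bij:
  fixes p :: "'a::field poly" and h :: "'a \<Rightarrow> 'b::field"
  assumes h: "ring_morphism h" and "surj h" and irr: "irreducible p"
  shows "irreducible (map_poly h p)"
proof -
  interpret ring_morphism h by (rule h)
  have nz: "h x \<noteq> 0" if "x \<noteq> 0" for x
    using mult[of x "inverse x"] that by (auto simp: one)
  have deg: "degree (map_poly h q) = degree q" for q
    by (cases "q = 0") (auto intro!: map_poly_degree_eq nz)
  have unit: "q dvd 1 \<longleftrightarrow> q \<noteq> 0 \<and> degree q = 0" for q :: "'c::field poly"
    by (cases "q = 0") (auto simp: is_unit_iff_degree)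
  have zero_iff: "map_poly h q = 0 \<longleftrightarrow> q = 0" for q
    by (metis deg degree_eq_zeroE leading_coeff_0_iff map_poly_0 map_poly_pCons nz pCons_eq_0_iff zero coeff_map_poly)
  have surj: "\<exists>q'. q = map_poly h q'" for q
  proof (intro exI poly_eqI)
    fix i
    have hz: "inv_into UNIV h 0 = 0" by (metis \<open>surj h\<close> nz surj_f_inv_f)
    show "coeff q i = coeff (map_poly h (map_poly (inv_into UNIV h) q)) i"
      using \<open>surj h\<close> by (simp add: coeff_map_poly zero hz surj_f_inv_f)
  qed
  show ?thesis
  proof (rule Factorial_Ring.irreducibleI)
    show "map_poly h p \<noteq> 0" "\<not> map_poly h p dvd 1"
      using irr by (auto simp: zero_iff unit deg Factorial_Ring.irreducible_def)
  next
    fix a b assume ab: "map_poly h p = a * b"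
    obtain a' b' where a'b': "a = map_poly h a'" "b = map_poly h b'" using surj by metis
    have "map_poly h (p - a' * b') = 0"
      using ab by (simp add: a'b' map_poly_diff map_poly_mult)
    then have "p = a' * b'" by (simp add: zero_iff)
    then have "a' dvd 1 \<or> b' dvd 1" using irr by (auto simp: Factorial_Ring.irreducible_def)
    then show "a dvd 1 \<or> b dvd 1" by (simp add: unit a'b' deg zero_iff)
  qed
qed

lemma rat_poly_common_denominator:
  "\<exists>N q. N \<noteq> 0 \<and> smult (of_int N) p = map_poly of_int (q :: int poly)" for p :: "rat poly"
proof (induction p)
  case 0
  show ?case by (intro exI[of _ 1] exI[of _ 0]) simp
next
  case (pCons a p)
  then obtain N q where Nq: "N \<noteq> 0" "smult (of_int N) p = map_poly of_int (q :: int poly)" by blast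
  obtain u v where uv: "a = of_int u / of_int v" "v > 0" by (cases a) (auto simp: Fract_of_int_quotient)
  have "smult (of_int (v * N)) (pCons a p) = map_poly of_int (pCons (u * N) (smult v q))"
    using uv Nq by (simp add: map_poly_pCons map_poly_smult flip: Nq(2))
  moreover have "v * N \<noteq> 0" using uv Nq by simp
  ultimately show ?case by blast
qed

text \<open>Gauss's lemma moves irreducibility from \<open>Z[t]\<close> to its fraction field.
  \<open>Qt\<close> is the fraction field of \<open>Q[t]\<close> instead, so the isomorphism
  \<open>\<psi>\<close> between the two fields transports it.\<close>

lemma irreducible_poly_to_K_qpoly:
  assumes "odd (coeff (c 1) 1)" and "n \<ge> 1"
  shows "irreducible (poly_to_K (qpoly c n))"
proof -
  define \<psi> where "\<psi> = fract_lift to_K"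
  note K = ring_morphism_to_K
  have Keq: "to_K x = 0 \<Longrightarrow> x = 0" for x by simp
  interpret \<psi>: ring_morphism \<psi>
    unfolding \<psi>_def by (rule fract_lift_hom[OF K Keq])
  interpret K: ring_morphism to_K by (rule K)
  have "surj \<psi>"
  proof (unfold surj_def, intro allI)
    fix y :: Qt
    obtain a b where y: "y = Fract a b" "b \<noteq> 0" by (cases y) auto
    obtain N q where Nq: "N \<noteq> 0" "smult (of_int N) a = map_poly of_int (q :: int poly)"
      using rat_poly_common_denominator by blast
    obtain M r where Mr: "M \<noteq> 0" "smult (of_int M) b = map_poly of_int (r :: int poly)"
      using rat_poly_common_denominator by blast
    have "r \<noteq> 0" using Mr y by (auto simp: )
    have cst: "to_K [:k:] = to_fract [:of_int k:]" for k
      by (simp add: to_K_def map_poly_pCons)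
    have qa: "to_K q = to_fract [:of_int N:] * to_fract a"
      by (simp add: to_K_def Nq(2)[symmetric] flip: to_fract_mult)
    have rb: "to_K r = to_fract [:of_int M:] * to_fract b"
      by (simp add: to_K_def Mr(2)[symmetric] flip: to_fract_mult)
    \<comment> \<open>If \<open>N a = q\<close> and \<open>M b = r\<close>, then
      \<open>a / b = (M q) / (N r)\<close>, a quotient of integer polynomials.\<close>
    have "\<psi> (Fract ([:M:] * q) ([:N:] * r)) = to_K ([:M:] * q) / to_K ([:N:] * r)"
      unfolding \<psi>_def using \<open>N \<noteq> 0\<close> \<open>r \<noteq> 0\<close> by (intro fract_lift_Fract K) auto
    also have "\<dots> = y"
      using Nq Mr y by (simp only: K.mult cst qa rb) (simp add: Fract_conv_to_fract)
    finally show "\<exists>x. y = \<psi> x" by metis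
  qed
  have "irreducible (fract_poly (qpoly c n))"
    using irreducible_qpoly_int[of c n] assms
    by (subst (asm) nonconst_poly_irreducible_iff) (auto simp: degree_qpoly)
  then have "irreducible (map_poly \<psi> (fract_poly (qpoly c n)))"
    by (rule irreducible_map_poly_bij[OF \<psi>.ring_morphism_axioms \<open>surj \<psi>\<close>])
  moreover have "\<psi> (to_fract a) = to_K a" for a
    unfolding \<psi>_def by (rule fract_lift_to_fract[OF K Keq])
  then have "map_poly \<psi> (fract_poly (qpoly c n)) = poly_to_K (qpoly c n)"
    unfolding poly_to_K_def by (subst map_poly_map_poly) (auto simp: o_def \<psi>.zero)
  ultimately show ?thesis by simp
qed

section \<open>Extending field embeddings by square roots\<close>

text \<open>Stated with the operations of the type; \<open>subfield_iff_subfield_set\<close> later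
  links it to the notion in the algebra library. Zero needs no exception, as
  \<open>inverse 0 = 0\<close>.\<close>

definition subfield_set :: "'a::field set \<Rightarrow> bool"
  where "subfield_set F \<longleftrightarrow> 1 \<in> F \<and> (\<forall>x\<in>F. \<forall>y\<in>F. x - y \<in> F \<and> x * y \<in> F) \<and> (\<forall>x\<in>F. inverse x \<in> F)"

lemma subfield_setD:
  assumes "subfield_set F"
  shows "1 \<in> F" "0 \<in> F" "x \<in> F \<Longrightarrow> y \<in> F \<Longrightarrow> x - y \<in> F" "x \<in> F \<Longrightarrow> y \<in> F \<Longrightarrow> x * y \<in> F"
    "x \<in> F \<Longrightarrow> inverse x \<in> F" "x \<in> F \<Longrightarrow> - x \<in> F" "x \<in> F \<Longrightarrow> y \<in> F \<Longrightarrow> x + y \<in> F"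
    "x \<in> F \<Longrightarrow> y \<in> F \<Longrightarrow> x / y \<in> F" "x \<in> F \<Longrightarrow> x ^ n \<in> F"
proof -
  show one: "1 \<in> F" and d: "x \<in> F \<Longrightarrow> y \<in> F \<Longrightarrow> x - y \<in> F"
    and m: "x \<in> F \<Longrightarrow> y \<in> F \<Longrightarrow> x * y \<in> F" and i: "x \<in> F \<Longrightarrow> inverse x \<in> F" for x y
    using assms by (auto simp: subfield_set_def)
  show z: "0 \<in> F" using d[OF one one] by simp
  show u: "x \<in> F \<Longrightarrow> - x \<in> F" for x using d[OF z, of x] by simp
  show "x \<in> F \<Longrightarrow> y \<in> F \<Longrightarrow> x + y \<in> F" using d[of x "- y"] u[of y] by simp
  show "x \<in> F \<Longrightarrow> y \<in> F \<Longrightarrow> x / y \<in> F" using m[of x "inverse y"] i[of y] by (simp add: divide_inverse)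
  show "x \<in> F \<Longrightarrow> x ^ n \<in> F" by (induction n) (auto intro: one m)
qed

definition hom_on :: "'a::field set \<Rightarrow> ('a \<Rightarrow> 'b::field) \<Rightarrow> bool"
  where "hom_on F \<phi> \<longleftrightarrow> \<phi> 1 = 1 \<and> (\<forall>x\<in>F. \<forall>y\<in>F. \<phi> (x + y) = \<phi> x + \<phi> y \<and> \<phi> (x * y) = \<phi> x * \<phi> y)"

lemma hom_onD:
  assumes "hom_on F \<phi>"
  shows "\<phi> 1 = 1" "x \<in> F \<Longrightarrow> y \<in> F \<Longrightarrow> \<phi> (x + y) = \<phi> x + \<phi> y"
    "x \<in> F \<Longrightarrow> y \<in> F \<Longrightarrow> \<phi> (x * y) = \<phi> x * \<phi> y"
  using assms by (auto simp: hom_on_def)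

lemma hom_on_diff:
  assumes "subfield_set F" "hom_on F \<phi>" "x \<in> F" "y \<in> F"
  shows "\<phi> (x - y) = \<phi> x - \<phi> y"
  using hom_onD(2)[OF assms(2), of "x - y" y] subfield_setD(3)[OF assms(1)] assms(3,4) by simp

lemma hom_on_0:
  assumes "subfield_set F" "hom_on F \<phi>"
  shows "\<phi> 0 = 0"
  using hom_on_diff[OF assms subfield_setD(1,1)[OF assms(1) ]] by simp

lemma hom_on_power:
  assumes "subfield_set F" "hom_on F \<phi>" "x \<in> F"
  shows "\<phi> (x ^ n) = \<phi> x ^ n"
  by (induction n) (simp_all add: hom_onD[OF assms(2)] subfield_setD[OF assms(1)] assms(3))

lemma hom_on_eq_0:
  assumes "subfield_set F" "hom_on F \<phi>" "x \<in> F" "\<phi> x = 0"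
  shows "x = 0"
proof (rule ccontr)
  assume "x \<noteq> 0"
  then have "\<phi> x * \<phi> (inverse x) = 1"
    using hom_onD(3)[OF assms(2,3), of "inverse x"] subfield_setD(5)[OF assms(1,3)] hom_onD(1)[OF assms(2)]
    by simp
  then show False using assms(4) by simp
qed

lemma hom_on_qval:
  assumes "subfield_set F" "hom_on F \<phi>" "x \<in> F" "\<And>i. c i \<in> F"
  shows "qval c n x \<in> F \<and> \<phi> (qval c n x) = qval (\<lambda>i. \<phi> (c i)) n (\<phi> x)"
  using assms(3)
proof (induction n arbitrary: x)
  case (Suc n)
  have "x ^ 2 + c (Suc n) \<in> F"
    using Suc.prems assms(4) by (intro subfield_setD[OF assms(1)])
  moreover have "\<phi> (x ^ 2 + c (Suc n)) = \<phi> x ^ 2 + \<phi> (c (Suc n))"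
    using Suc.prems assms(4)
    by (simp add: hom_onD(2)[OF assms(2)] hom_on_power[OF assms(1,2)] subfield_setD(9)[OF assms(1)])
  ultimately show ?case using Suc.IH by simp
qed simp

text \<open>This is the field \<open>F(a)\<close> as soon as \<open>a ^ 2 \<in> F\<close>, and
  \<open>F\<close> itself if \<open>a \<in> F\<close>.\<close>

definition sqrt_ext :: "'a::field set \<Rightarrow> 'a \<Rightarrow> 'a set"
  where "sqrt_ext F a = {x + y * a | x y. x \<in> F \<and> y \<in> F}"

lemma sqrt_ext_base:
  assumes "subfield_set F"
  shows "F \<subseteq> sqrt_ext F a" "a \<in> sqrt_ext F a"
proof -
  show "a \<in> sqrt_ext F a"
    unfolding sqrt_ext_def using subfield_setD(1,2)[OF assms] by (force intro: exI[of _ 0] exI[of _ 1])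
  show "F \<subseteq> sqrt_ext F a"
  proof
    fix x assume "x \<in> F"
    then show "x \<in> sqrt_ext F a"
      unfolding sqrt_ext_def using subfield_setD(2)[OF assms] by (force intro: exI[of _ x] exI[of _ 0])
  qed
qed

lemma sqrt_ext_subset:
  assumes "subfield_set F'" "F \<subseteq> F'" "a \<in> F'"
  shows "sqrt_ext F a \<subseteq> F'"
  using assms(2,3) by (auto simp: sqrt_ext_def intro!: subfield_setD[OF assms(1)])

lemma subfield_set_sqrt_ext:
  assumes F: "subfield_set F" and a: "a ^ 2 \<in> F"
  shows "subfield_set (sqrt_ext F a)"
  unfolding subfield_set_def
proof (intro conjI ballI)
  note D = subfield_setD[OF F]
  show "1 \<in> sqrt_ext F a" using sqrt_ext_base(1)[OF F] D(1) by auto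
next
  note D = subfield_setD[OF F]
  fix z w assume "z \<in> sqrt_ext F a" "w \<in> sqrt_ext F a"
  then obtain x y x' y' where z: "z = x + y * a" and w: "w = x' + y' * a"
    and mem: "x \<in> F" "y \<in> F" "x' \<in> F" "y' \<in> F" by (auto simp: sqrt_ext_def)
  have "z - w = (x - x') + (y - y') * a" by (simp add: z w algebra_simps)
  then show "z - w \<in> sqrt_ext F a" unfolding sqrt_ext_def using mem D(3) by blast
  have "z * w = (x * x' + y * y' * a ^ 2) + (x * y' + y * x') * a"
    by (simp add: z w algebra_simps power2_eq_square)
  moreover have "x * x' + y * y' * a ^ 2 \<in> F" "x * y' + y * x' \<in> F"
    using mem a by (auto intro!: D(7) D(4))
  ultimately show "z * w \<in> sqrt_ext F a" unfolding sqrt_ext_def by blast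
next
  note D = subfield_setD[OF F]
  fix z assume "z \<in> sqrt_ext F a"
  then obtain x y where z: "z = x + y * a" and mem: "x \<in> F" "y \<in> F" by (auto simp: sqrt_ext_def)
  define N where "N = x ^ 2 - y ^ 2 * a ^ 2"
  have N: "N = (x + y * a) * (x - y * a)" by (simp add: N_def algebra_simps power2_eq_square)
  have "N \<in> F" unfolding N_def using mem a by (auto intro!: D(3,4,9))
  \<comment> \<open>If the norm vanishes and \<open>z\<close> does not, then
    \<open>x = y * a\<close>, so \<open>z = x + x\<close> already lies in \<open>F\<close>.\<close>
  consider "z = 0" | "x = y * a" | "N \<noteq> 0" using N z by auto
  then show "inverse z \<in> sqrt_ext F a"
  proof cases
    case 1
    then show ?thesis using sqrt_ext_base(1)[OF F] D(2) by auto
  next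
    case 2
    then have "z = x + x" using z by simp
    then have "z \<in> F" using D(7)[OF mem(1,1)] by simp
    then show ?thesis using sqrt_ext_base(1)[OF F] D(5) by auto
  next
    case 3
    then have "inverse z = (x - y * a) / N"
      unfolding N z by (simp add: divide_inverse)
    then have "inverse z = x / N + (- y / N) * a"
      by (simp add: diff_divide_distrib)
    moreover have "x / N \<in> F" "- y / N \<in> F" using mem \<open>N \<in> F\<close> D(6,8) by blast+
    ultimately show ?thesis unfolding sqrt_ext_def by blast
  qed
qed

text \<open>The extension sends \<open>x + y * a\<close> to \<open>\<phi> x + \<phi> y * l\<close>,
  which is well defined since the coordinates are unique when \<open>a \<notin> F\<close>. If
  \<open>a \<in> F\<close>, the field does not grow and \<open>\<phi>\<close> serves, whichever root
  \<open>l\<close> is.\<close>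

lemma hom_on_sqrt_ext:
  fixes \<phi> :: "'a::field \<Rightarrow> 'b::field"
  assumes F: "subfield_set F" and h: "hom_on F \<phi>" and a: "a ^ 2 \<in> F" and l: "l ^ 2 = \<phi> (a ^ 2)"
  shows "\<exists>\<phi>'. hom_on (sqrt_ext F a) \<phi>' \<and> (\<forall>x\<in>F. \<phi>' x = \<phi> x)"
proof (cases "a \<in> F")
  case True
  then have "sqrt_ext F a = F" using sqrt_ext_base(1)[OF F] sqrt_ext_subset[OF F] by blast
  then show ?thesis using h by auto
next
  case False
  note D = subfield_setD[OF F] and H = hom_onD[OF h]
  have uniq: "x = x' \<and> y = y'" if "x + y * a = x' + y' * a" "x \<in> F" "y \<in> F" "x' \<in> F" "y' \<in> F" for x y x' y'
  proof -
    have "y = y'"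
    proof (rule ccontr)
      assume "y \<noteq> y'"
      moreover have "a * (y - y') = x' - x" using that(1) by (simp add: algebra_simps)
      ultimately have "a = (x' - x) / (y - y')" by (simp add: nonzero_eq_divide_eq)
      moreover have "(x' - x) / (y - y') \<in> F" by (rule D(8)[OF D(3)[OF that(4,2)] D(3)[OF that(3,5)]])
      ultimately show False using False by simp
    qed
    then show ?thesis using that by simp
  qed
  define \<phi>' where "\<phi>' z = (case (SOME p. z = fst p + snd p * a \<and> fst p \<in> F \<and> snd p \<in> F) of (x, y) \<Rightarrow> \<phi> x + \<phi> y * l)" for z
  have phi': "\<phi>' (x + y * a) = \<phi> x + \<phi> y * l" if "x \<in> F" "y \<in> F" for x y
  proof -
    have "(SOME p. x + y * a = fst p + snd p * a \<and> fst p \<in> F \<and> snd p \<in> F) = (x, y)"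
    proof (rule some_equality)
      fix p assume "x + y * a = fst p + snd p * a \<and> fst p \<in> F \<and> snd p \<in> F"
      then show "p = (x, y)" using uniq[of x y "fst p" "snd p"] that by (simp add: prod_eq_iff)
    qed (simp add: that)
    then show ?thesis by (simp add: \<phi>'_def)
  qed
  have ext: "\<phi>' x = \<phi> x" if "x \<in> F" for x
    using phi'[of x 0] that D(2) hom_on_0[OF F h] by simp
  have "hom_on (sqrt_ext F a) \<phi>'"
    unfolding hom_on_def
  proof (intro conjI ballI)
    show "\<phi>' 1 = 1" using ext D(1) H(1) by simp
  next
    fix z w assume "z \<in> sqrt_ext F a" "w \<in> sqrt_ext F a"
    then obtain x y x' y' where z: "z = x + y * a" and w: "w = x' + y' * a"
      and mem: "x \<in> F" "y \<in> F" "x' \<in> F" "y' \<in> F" by (auto simp: sqrt_ext_def)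
    have "z + w = (x + x') + (y + y') * a" by (simp add: z w algebra_simps)
    then have "\<phi>' (z + w) = \<phi> (x + x') + \<phi> (y + y') * l" using mem D(7) by (simp only: phi')
    also have "\<dots> = \<phi>' z + \<phi>' w"
      unfolding z w phi'[OF mem(1,2)] phi'[OF mem(3,4)] by (simp add: mem H distrib_right)
    finally show "\<phi>' (z + w) = \<phi>' z + \<phi>' w" .
    have zw: "z * w = (x * x' + y * y' * a ^ 2) + (x * y' + y * x') * a"
      by (simp add: z w algebra_simps power2_eq_square)
    have "\<phi>' (z * w) = \<phi> (x * x' + y * y' * a ^ 2) + \<phi> (x * y' + y * x') * l"
      unfolding zw using mem a by (intro phi') (auto intro!: D(7) D(4))
    also have "\<phi> (x * x' + y * y' * a ^ 2) = \<phi> x * \<phi> x' + \<phi> y * \<phi> y' * l ^ 2"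
      unfolding l using mem a D(4,7) by (simp add: H)
    also have "\<phi> (x * y' + y * x') = \<phi> x * \<phi> y' + \<phi> y * \<phi> x'"
      using mem D(4,7) by (simp add: H)
    finally show "\<phi>' (z * w) = \<phi>' z * \<phi>' w"
      unfolding z w phi'[OF mem(1,2)] phi'[OF mem(3,4)] by (simp add: algebra_simps power2_eq_square)
  qed
  then show ?thesis using ext by blast
qed

text \<open>All squares lie in the initial field, where the morphism never changes, so the roots can
  be adjoined one at a time.\<close>

lemma hom_on_adjoin_sqrts:
  fixes \<phi> :: "'a::field \<Rightarrow> 'b::field"
  assumes "finite A" "subfield_set F" "hom_on F \<phi>"
    and "\<And>a. a \<in> A \<Longrightarrow> a ^ 2 \<in> F \<and> (\<exists>l. l ^ 2 = \<phi> (a ^ 2))"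
  obtains F' \<phi>' where "subfield_set F'" "hom_on F' \<phi>'" "F \<subseteq> F'" "A \<subseteq> F'" "\<And>x. x \<in> F \<Longrightarrow> \<phi>' x = \<phi> x"
proof -
  have "\<exists>F' \<phi>'. subfield_set F' \<and> hom_on F' \<phi>' \<and> F \<subseteq> F' \<and> A \<subseteq> F' \<and> (\<forall>x\<in>F. \<phi>' x = \<phi> x)"
    using assms(1,4)
  proof (induction A)
    case empty
    then show ?case using assms(2,3) by auto
  next
    case (insert a A)
    then obtain F' \<phi>' where 1: "subfield_set F'" "hom_on F' \<phi>'" "F \<subseteq> F'" "A \<subseteq> F'" "\<forall>x\<in>F. \<phi>' x = \<phi> x"
      using insert.IH insert.prems by auto
    from insert.prems obtain l where l: "a ^ 2 \<in> F" "l ^ 2 = \<phi> (a ^ 2)" by blast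
    then have l': "a ^ 2 \<in> F'" "l ^ 2 = \<phi>' (a ^ 2)" using 1 by auto
    obtain \<phi>'' where "hom_on (sqrt_ext F' a) \<phi>''" "\<forall>x\<in>F'. \<phi>'' x = \<phi>' x"
      using hom_on_sqrt_ext[OF 1(1,2) l'] by blast
    then show ?case
      using subfield_set_sqrt_ext[OF 1(1) l'(1)] sqrt_ext_base[OF 1(1), of a] 1
      by (intro exI[of _ "sqrt_ext F' a"] exI[of _ \<phi>'']) auto
  qed
  then show ?thesis using that by blast
qed

section \<open>Simple extensions by a root of an irreducible polynomial\<close>

lemma bezout_irreducible:
  fixes g p :: "'a::field poly"
  assumes irr: "irreducible g" and "\<not> g dvd p"
  shows "\<exists>u v. u * p + v * g = 1"
proof -
  define I where "I = {d. \<exists>u v. d = u * p + v * g}"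
  have "g \<noteq> 0" using irr by auto
  have "g \<in> I" unfolding I_def by (rule CollectI, intro exI[of _ 0] exI[of _ 1]) simp
  have "p \<in> I" unfolding I_def by (rule CollectI, intro exI[of _ 1] exI[of _ 0]) simp
  \<comment> \<open>A nonzero element of least degree divides both \<open>g\<close> and
    \<open>p\<close>. Since \<open>g\<close> does not divide \<open>p\<close>, it is not an
    associate of \<open>g\<close>, hence it is a unit.\<close>
  obtain d where d: "d \<in> I" "d \<noteq> 0" and min: "\<And>e. e \<in> I \<Longrightarrow> e \<noteq> 0 \<Longrightarrow> degree d \<le> degree e"
    using ex_has_least_nat[of "\<lambda>e. e \<in> I \<and> e \<noteq> 0" g degree] \<open>g \<in> I\<close> \<open>g \<noteq> 0\<close> by blast
  have dvd: "d dvd q" if qI: "q \<in> I" for q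
  proof (rule ccontr)
    assume "\<not> d dvd q"
    then have "q mod d \<noteq> 0" by (simp add: dvd_eq_mod_eq_0)
    moreover have "q mod d \<in> I"
    proof -
      obtain u v u' v' where "q = u * p + v * g" "d = u' * p + v' * g"
        using qI d(1) unfolding I_def by blast
      then have "q mod d = (u - q div d * u') * p + (v - q div d * v') * g"
        unfolding minus_div_mult_eq_mod[symmetric] by (simp add: algebra_simps)
      then show ?thesis unfolding I_def by blast
    qed
    ultimately show False using min degree_mod_less[OF d(2), of q] by force
  qed
  from dvd[OF \<open>g \<in> I\<close>] obtain e where e: "g = d * e" by (elim dvdE)
  then have "d dvd 1 \<or> e dvd 1" using irr by (auto simp: Factorial_Ring.irreducible_def)
  moreover have "\<not> e dvd 1"
  proof
    assume "e dvd 1"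
    then have "g dvd d" by (simp add: e mult_unit_dvd_iff)
    then show False using dvd[OF \<open>p \<in> I\<close>] assms(2) by (auto dest: dvd_trans)
  qed
  ultimately obtain w where w: "1 = d * w" by (meson dvdE)
  obtain u v where "d = u * p + v * g" using d(1) unfolding I_def by blast
  then have "(w * u) * p + (w * v) * g = d * w" by (simp add: algebra_simps)
  then have "(w * u) * p + (w * v) * g = 1" by (simp only: w)
  then show ?thesis by blast
qed

text \<open>\<open>P\<close> and \<open>Q\<close> evaluate polynomials at \<open>b\<close> and
  \<open>y\<close>. The kernel of \<open>P\<close> is the ideal of \<open>g\<close>, which
  \<open>Q\<close> annihilates, so \<open>Q\<close> factors through \<open>P\<close>. Hence any root
  of \<open>g\<close> can be sent to any chosen root on the other side.\<close>

lemma hom_on_simple_ext: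
  fixes \<iota> :: "'k::field \<Rightarrow> 'a::field" and \<sigma> :: "'k \<Rightarrow> 'b::field"
  assumes "ring_morphism \<iota>" "ring_morphism \<sigma>" and irr: "irreducible g"
    and b: "poly (map_poly \<iota> g) b = 0" and y: "poly (map_poly \<sigma> g) y = 0"
  obtains F \<phi> where "subfield_set F" "hom_on F \<phi>" "range \<iota> \<subseteq> F" "b \<in> F" "\<phi> b = y" "\<And>x. \<phi> (\<iota> x) = \<sigma> x"
proof -
  interpret i: ring_morphism \<iota> by fact
  interpret s: ring_morphism \<sigma> by fact
  define P where "P p = poly (map_poly \<iota> p) b" for p
  define Q where "Q p = poly (map_poly \<sigma> p) y" for p
  have P: "P (p + q) = P p + P q" "P (p - q) = P p - P q" "P (p * q) = P p * P q" "P 1 = 1" "P g = 0" for p q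
    by (simp_all add: P_def i.map_poly_add i.map_poly_diff i.map_poly_mult i.one b)
  have Q: "Q (p + q) = Q p + Q q" "Q (p - q) = Q p - Q q" "Q (p * q) = Q p * Q q" "Q 1 = 1" "Q g = 0" for p q
    by (simp_all add: Q_def s.map_poly_add s.map_poly_diff s.map_poly_mult s.one y)
  have unit: "\<exists>u. P u * P p = 1" if "P p \<noteq> 0" for p
  proof -
    have "\<not> g dvd p" using that P by (auto elim!: dvdE)
    then obtain u v where "u * p + v * g = 1" using bezout_irreducible[OF irr] by blast
    then have "P (u * p + v * g) = 1" by (simp only: P)
    then show ?thesis by (auto simp: P)
  qed
  have dvd: "g dvd p" if "P p = 0" for p
  proof (rule ccontr)
    assume "\<not> g dvd p"
    then obtain u v where "u * p + v * g = 1" using bezout_irreducible[OF irr] by blast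
    then have "P (u * p + v * g) = 1" by (simp only: P)
    then show False using that by (simp add: P)
  qed
  have "Q p = 0" if "P p = 0" for p
  proof -
    have "g dvd p" using that by (rule dvd)
    then show ?thesis using Q by (auto elim!: dvdE)
  qed
  then have wd: "Q p = Q q" if "P p = P q" for p q
    using that P(2)[of p q] Q(2)[of p q] by simp
  define \<phi> where "\<phi> z = Q (SOME p. P p = z)" for z
  have phi: "\<phi> (P p) = Q p" for p
    unfolding \<phi>_def by (rule wd, rule someI[of "\<lambda>q. P q = P p" p]) simp
  show ?thesis
  proof (rule that)
    show "subfield_set (range P)"
      unfolding subfield_set_def
    proof (intro conjI ballI)
      show "1 \<in> range P" using P(4) by (intro range_eqI[of _ _ 1]) simp
    next
      fix x y assume "x \<in> range P" "y \<in> range P"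
      then obtain p q where "x = P p" "y = P q" by blast
      then have "x - y = P (p - q)" "x * y = P (p * q)" by (simp_all only: P)
      then show "x - y \<in> range P" "x * y \<in> range P" by blast+
    next
      fix x assume "x \<in> range P"
      then obtain p where p: "x = P p" by blast
      show "inverse x \<in> range P"
      proof (cases "x = 0")
        case False
        then obtain u where "P u * x = 1" using unit p by blast
        then have "inverse x = P u" by (simp add: inverse_unique mult.commute)
        then show ?thesis by blast
      qed (use p in auto)
    qed
    show "hom_on (range P) \<phi>"
      unfolding hom_on_def
    proof (intro conjI ballI)
      show "\<phi> 1 = 1" using phi[of 1] by (simp only: P Q)
    next
      fix x y assume "x \<in> range P" "y \<in> range P"
      then obtain p q where pq: "x = P p" "y = P q" by blast
      show "\<phi> (x + y) = \<phi> x + \<phi> y" using phi[of "p + q"] by (simp only: pq P Q phi)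
      show "\<phi> (x * y) = \<phi> x * \<phi> y" using phi[of "p * q"] by (simp only: pq P Q phi)
    qed
    have c: "P [:x:] = \<iota> x" "Q [:x:] = \<sigma> x" for x
      by (simp_all add: P_def Q_def map_poly_pCons i.zero s.zero)
    show "range \<iota> \<subseteq> range P" by (auto simp flip: c(1))
    show "\<phi> (\<iota> x) = \<sigma> x" for x using phi[of "[:x:]"] by (simp only: c)
    have X: "P [:0, 1:] = b" "Q [:0, 1:] = y"
      by (simp_all add: P_def Q_def map_poly_pCons i.zero s.zero i.one s.one)
    show "b \<in> range P" unfolding X(1)[symmetric] by (rule rangeI)
    show "\<phi> b = y" using phi[of "[:0, 1:]"] by (simp only: X)
  qed
qed

section \<open>Ramification at a complex point\<close>

definition taylor :: "complex \<Rightarrow> rat poly \<Rightarrow> complex fps"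
  where "taylor \<tau> p = fps_of_poly (pcompose (map_poly of_rat p) [:\<tau>, 1:])"

definition taylor_int :: "complex \<Rightarrow> int poly \<Rightarrow> complex fps"
  where "taylor_int \<tau> p = fps_of_poly (pcompose (map_poly of_int p) [:\<tau>, 1:])"

text \<open>Laurent expansion in powers of \<open>t - \<tau>\<close>; the lift is an embedding
  because Taylor expansion is injective.\<close>

definition place :: "complex \<Rightarrow> Qt \<Rightarrow> complex fls"
  where "place \<tau> = fract_lift (\<lambda>p. fps_to_fls (taylor \<tau> p))"

lemma ring_morphism_taylor: "ring_morphism (taylor \<tau>)"
proof -
  interpret i: ring_morphism "of_rat :: rat \<Rightarrow> complex" by (rule ring_morphism_of_rat)
  show ?thesis
    by standard (simp_all add: taylor_def i.map_poly_add i.map_poly_mult pcompose_add pcompose_mult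
        fps_of_poly_add fps_of_poly_mult pcompose_1)
qed

lemma ring_morphism_taylor_int: "ring_morphism (taylor_int \<tau>)"
proof -
  interpret i: ring_morphism "of_int :: int \<Rightarrow> complex" by (rule ring_morphism_of_int)
  show ?thesis
    by standard (simp_all add: taylor_int_def i.map_poly_add i.map_poly_mult pcompose_add pcompose_mult
        fps_of_poly_add fps_of_poly_mult pcompose_1)
qed

lemma ring_morphism_fps_to_fls: "ring_morphism (fps_to_fls :: 'a::comm_ring_1 fps \<Rightarrow> 'a fls)"
  by standard (simp_all add: fls_times_fps_to_fls)

lemma taylor_eq_0: "taylor \<tau> p = 0 \<Longrightarrow> p = 0"
proof -
  assume "taylor \<tau> p = 0"
  then have "pcompose (map_poly of_rat p) [:\<tau>, 1:] = (0 :: complex poly)"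
    using fps_of_poly_eq_iff[of _ 0] by (simp add: taylor_def)
  then have "map_poly of_rat p = (0 :: complex poly)"
    by (rule pcompose_eq_0) simp
  then show "p = 0"
    by (auto simp: poly_eq_iff coeff_map_poly)
qed

lemma taylor_int_nth:
  "taylor_int \<tau> p $ 0 = poly (map_poly of_int p) \<tau>"
  "taylor_int \<tau> p $ 1 = poly (pderiv (map_poly of_int p)) \<tau>"
proof -
  show "taylor_int \<tau> p $ 0 = poly (map_poly of_int p) \<tau>"
    by (simp add: taylor_int_def)
  define q where "q = (map_poly of_int p :: complex poly)"
  have "coeff (pcompose q [:\<tau>, 1:]) 1 = poly (pderiv (pcompose q [:\<tau>, 1:])) 0"
    by (simp add: poly_0_coeff_0 coeff_pderiv)
  also have "\<dots> = poly (pderiv q) \<tau>"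
    by (simp add: pderiv_pcompose poly_pcompose pderiv_pCons)
  finally show "taylor_int \<tau> p $ 1 = poly (pderiv (map_poly of_int p)) \<tau>"
    by (simp add: taylor_int_def q_def)
qed

lemma ring_morphism_fls_taylor: "ring_morphism (\<lambda>p. fps_to_fls (taylor \<tau> p))"
  by (rule ring_morphism.comp[OF ring_morphism_taylor ring_morphism_fps_to_fls])

lemma ring_morphism_place: "ring_morphism (place \<tau>)"
  unfolding place_def by (rule fract_lift_hom[OF ring_morphism_fls_taylor]) (auto dest: taylor_eq_0)

lemma place_to_K: "place \<tau> (to_K p) = fps_to_fls (taylor_int \<tau> p)"
proof -
  have "place \<tau> (to_K p) = fps_to_fls (taylor \<tau> (map_poly of_int p))"
    unfolding place_def to_K_def
    by (rule fract_lift_to_fract[OF ring_morphism_fls_taylor]) (auto dest: taylor_eq_0)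
  also have "taylor \<tau> (map_poly of_int p) = taylor_int \<tau> p"
    by (simp add: taylor_def taylor_int_def map_poly_map_poly o_def)
  finally show ?thesis .
qed

text \<open>The constant term can be prescribed, which lets \<open>exists_special_root_aux\<close>
  lift a given complex root.\<close>

lemma fps_sqrt_exists:
  fixes a :: "complex fps"
  assumes "a $ 0 \<noteq> 0" and "w ^ 2 = a $ 0"
  shows "\<exists>z. z ^ 2 = a \<and> z $ 0 = w"
  using power_radical[of a "\<lambda>_ _. w" 1] assms
  by (intro exI[of _ "fps_radical (\<lambda>_ _. w) 2 a"]) (simp add: numeral_2_eq_2)

lemma qval_diff_dvd:
  fixes c :: "nat \<Rightarrow> 'a::idom"
  assumes "qval c n y = 0"
  shows "(w - y) dvd qval c n w"
proof -
  have "[:- y, 1:] dvd qpoly c n" using assms by (simp add: poly_eq_0_iff_dvd[symmetric] poly_qpoly)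
  then obtain q where q: "qpoly c n = [:- y, 1:] * q" by (elim dvdE)
  have "qval c n w = (w - y) * poly q w"
    using arg_cong[OF q, of "\<lambda>p. poly p w"] by (simp add: poly_qpoly algebra_simps)
  then show ?thesis by simp
qed

text \<open>For power series, two distinct roots with the constant term of \<open>w\<close> thus
  force \<open>qval c n w\<close> to vanish to order at least 2.\<close>

lemma qval_diff_mult_dvd:
  fixes c :: "nat \<Rightarrow> 'a::idom"
  assumes "qval c n y = 0" "qval c n y' = 0" "y \<noteq> y'"
  shows "(w - y) * (w - y') dvd qval c n w"
proof -
  have "[:- y, 1:] dvd qpoly c n" using assms by (simp add: poly_eq_0_iff_dvd[symmetric] poly_qpoly)
  then obtain q where q: "qpoly c n = [:- y, 1:] * q" by (elim dvdE)
  have "(y' - y) * poly q y' = 0"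
    using arg_cong[OF q, of "\<lambda>p. poly p y'"] assms(2) by (auto simp: poly_qpoly algebra_simps)
  then have "[:- y', 1:] dvd q" using assms(3) by (simp add: poly_eq_0_iff_dvd[symmetric])
  then obtain r where r: "q = [:- y', 1:] * r" by (elim dvdE)
  have "qval c n w = (w - y) * (w - y') * poly r w"
    using arg_cong[OF q[unfolded r], of "\<lambda>p. poly p w"] by (simp add: poly_qpoly algebra_simps)
  then show ?thesis by simp
qed

text \<open>With \<open>n = Suc m\<close>, the simple zero of \<open>\<gamma>\<^sub>n(0)\<close>
  makes one of the new square roots ramify above \<tau>, while the nonvanishing of the earlier
  values keeps all lower levels unramified.\<close>

locale ramified_place =
  fixes c :: "nat \<Rightarrow> int poly" and \<tau> :: complex and m :: nat
  assumes simple: "poly (pderiv (map_poly of_int (qval c (Suc m) 0))) \<tau> \<noteq> 0"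
    and zero: "poly (map_poly of_int (qval c (Suc m) 0)) \<tau> = 0"
    and nonzero: "\<And>j. 1 \<le> j \<Longrightarrow> j \<le> m \<Longrightarrow> poly (map_poly of_int (qval c j 0)) \<tau> \<noteq> 0"
begin

abbreviation T :: "nat \<Rightarrow> complex fps"
  where "T i \<equiv> taylor_int \<tau> (c i)"

lemma ring_morphism_fps_nth_0: "ring_morphism (\<lambda>f :: complex fps. f $ 0)"
  by standard simp_all

lemma taylor_qval: "taylor_int \<tau> (qval c n x) = qval T n (taylor_int \<tau> x)"
  by (rule ring_morphism.qval_hom[OF ring_morphism_taylor_int])

lemma qval_T_nth_0: "qval T n x $ 0 = qval (\<lambda>i. T i $ 0) n (x $ 0)"
  by (rule ring_morphism.qval_hom[OF ring_morphism_fps_nth_0])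

lemma crit_nth_0: "qval (\<lambda>i. T i $ 0) n 0 = poly (map_poly of_int (qval c n 0)) \<tau>"
proof -
  have "taylor_int \<tau> (qval c n 0) $ 0 = qval T n 0 $ 0"
    by (simp add: taylor_qval ring_morphism.zero[OF ring_morphism_taylor_int])
  then show ?thesis by (simp add: taylor_int_nth(1) qval_T_nth_0)
qed

text \<open>The next composition at 0 is the \<open>j\<close>-th one at \<open>c (Suc j)\<close>. If
  \<open>y\<close> agreed with \<open>c (Suc j)\<close> at \<tau>, that value would vanish
  there.\<close>

lemma unit_at_lower_root:
  assumes "j < m" and "qval T j y = 0"
  shows "(y - T (Suc j)) $ 0 \<noteq> 0"
proof
  assume "(y - T (Suc j)) $ 0 = 0"
  then have "y $ 0 = T (Suc j) $ 0" by simp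
  then have "qval (\<lambda>i. T i $ 0) (Suc j) 0 = qval T j y $ 0"
    by (simp add: qval_T_nth_0)
  then show False
    using assms nonzero[of "Suc j"] by (simp add: crit_nth_0 del: qval.simps(2))
qed

text \<open>Evaluating the \<open>m\<close>-th composition at \<open>c (Suc m)\<close> gives the
  next one at 0, which has a simple zero at \<tau>.\<close>

lemma value_at_crit_nth_0: "qval T m (T (Suc m)) $ 0 = 0" "qval T m (T (Suc m)) $ 1 \<noteq> 0"
proof -
  have "qval T m (T (Suc m)) = taylor_int \<tau> (qval c (Suc m) 0)"
    by (simp add: taylor_qval ring_morphism.zero[OF ring_morphism_taylor_int])
  then show "qval T m (T (Suc m)) $ 0 = 0" "qval T m (T (Suc m)) $ 1 \<noteq> 0"
    using simple zero by (simp_all only: taylor_int_nth not_False_eq_True)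
qed

text \<open>A complex root \<open>w\<close> of the composition with constants evaluated at \<tau>
  lifts to a power series root, one square root at a time. At no positive level is \<open>w\<close>
  zero, since then some \<open>\<gamma>\<^sub>j(0)\<close> would vanish at \<tau>.\<close>

lemma exists_special_root_aux:
  assumes "qval (\<lambda>i. T i $ 0) k w = 0" and "k \<le> m" and "\<And>j. 1 \<le> j \<Longrightarrow> j \<le> m \<Longrightarrow> qval (\<lambda>i. T i $ 0) j 0 \<noteq> 0"
  shows "\<exists>y. qval T k y = 0 \<and> y $ 0 = w"
  using assms(1,2)
proof (induction k arbitrary: w)
  case 0
  then show ?case by (intro exI[of _ 0]) simp
next
  case (Suc k)
  obtain z where z: "qval T k z = 0" "z $ 0 = w ^ 2 + T (Suc k) $ 0"
    using Suc.IH[of "w ^ 2 + T (Suc k) $ 0"] Suc.prems by auto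
  have "w \<noteq> 0" using Suc.prems assms(3)[of "Suc k"] by auto
  then have "\<exists>y. y ^ 2 = z - T (Suc k) \<and> y $ 0 = w"
    by (intro fps_sqrt_exists) (simp_all add: z(2))
  then obtain y where "y ^ 2 = z - T (Suc k)" "y $ 0 = w" by blast
  then show ?case using z by (intro exI[of _ y]) simp
qed

lemma exists_special_root: "\<exists>y. qval T m y = 0 \<and> (y - T (Suc m)) $ 0 = 0"
proof -
  have "qval (\<lambda>i. T i $ 0) m (T (Suc m) $ 0) = 0"
    using zero crit_nth_0[of "Suc m"] by simp
  then show ?thesis
    using exists_special_root_aux[of m "T (Suc m) $ 0"] nonzero by (auto simp: crit_nth_0)
qed

text \<open>\<open>T (Suc m) - y\<close> divides a series of valuation 1, so its own valuation
  cannot be 2 or more.\<close>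

lemma special_root_valuation:
  assumes "qval T m y = 0" "(y - T (Suc m)) $ 0 = 0"
  shows "(y - T (Suc m)) $ 1 \<noteq> 0"
proof
  assume 0: "(y - T (Suc m)) $ 1 = 0"
  obtain q where "qval T m (T (Suc m)) = (T (Suc m) - y) * q"
    using qval_diff_dvd[OF assms(1)] by (meson dvdE)
  then have "qval T m (T (Suc m)) $ 1 = 0"
    using 0 assms(2) by (simp add: fps_mult_nth_1)
  then show False using value_at_crit_nth_0(2) by simp
qed

text \<open>A second root with this constant term would make the same series vanish to order
  2.\<close>

lemma unit_at_other_root:
  assumes "qval T m y = 0" "(y - T (Suc m)) $ 0 = 0" "qval T m y' = 0" "y' \<noteq> y"
  shows "(y' - T (Suc m)) $ 0 \<noteq> 0"
proof
  assume 0: "(y' - T (Suc m)) $ 0 = 0"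
  obtain q where "qval T m (T (Suc m)) = (T (Suc m) - y) * (T (Suc m) - y') * q"
    using qval_diff_mult_dvd[OF assms(1,3), of "T (Suc m)"] assms(4) by (metis dvdE)
  then have "qval T m (T (Suc m)) $ 1 = 0"
    using 0 assms(2) by (simp add: fps_mult_nth_1)
  then show False using value_at_crit_nth_0(2) by simp
qed

end

text \<open>The valuation of a nonzero square is even, whereas \<open>f\<close> has valuation
  1.\<close>

lemma fps_to_fls_not_square:
  fixes f :: "complex fps"
  assumes "f $ 0 = 0" "f $ 1 \<noteq> 0"
  shows "x ^ 2 \<noteq> fps_to_fls f"
proof
  assume x: "x ^ 2 = fps_to_fls f"
  have "subdegree f = 1" using assms by (intro subdegreeI) auto
  then have "fls_subdegree (x ^ 2) = 1" by (simp add: x fls_subdegree_fls_to_fps)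
  moreover have "fls_subdegree (x ^ 2) = 2 * fls_subdegree x"
    by (cases "x = 0") (simp_all add: power2_eq_square)
  ultimately show False by presburger
qed

section \<open>Extending the place to the roots of the compositions\<close>

abbreviation acK :: "(nat \<Rightarrow> int poly) \<Rightarrow> nat \<Rightarrow> Qt alg_closure"
  where "acK c i \<equiv> to_ac (to_K (c i))"

definition qroots :: "(nat \<Rightarrow> int poly) \<Rightarrow> nat \<Rightarrow> Qt alg_closure set"
  where "qroots c n = {x. qval (acK c) n x = 0}"

lemma finite_qroots: "finite (qroots c n)"
proof -
  have "qpoly (acK c) n \<noteq> 0" using degree_qpoly[of "acK c" n] by auto
  then show ?thesis
    using poly_roots_finite[of "qpoly (acK c) n"] by (simp add: poly_qpoly qroots_def)
qed

lemma qval_map_poly_hom: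
  assumes "ring_morphism h"
  shows "poly (map_poly h (poly_to_K (qpoly c n))) x = qval (\<lambda>i. h (to_K (c i))) n x"
  by (simp add: poly_to_K_def ring_morphism.map_poly_qpoly[OF ring_morphism_to_K]
      ring_morphism.map_poly_qpoly[OF assms] poly_qpoly)

context ramified_place
begin

text \<open>\<open>F\<close> is the domain of an extension of the place that sends \<open>b\<close>
  to the special root. The other \<open>\<alpha> x\<close> have squares that map to units, so they
  can be included; \<open>\<alpha> b\<close> cannot, because its square maps to a series of
  valuation 1.\<close>

lemma sqrt_not_in_extension:
  assumes irr: "irreducible (poly_to_K (qpoly c m))"
    and b: "b \<in> qroots c m"
    and \<alpha>: "\<And>x. x \<in> qroots c m \<Longrightarrow> \<alpha> x ^ 2 = x - acK c (Suc m)"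
  shows "\<exists>F. subfield_set F \<and> range to_ac \<subseteq> F \<and> qroots c m \<subseteq> F \<and> \<alpha> ` (qroots c m - {b}) \<subseteq> F \<and> \<alpha> b \<notin> F"
proof -
  interpret fl: ring_morphism "fps_to_fls :: complex fps \<Rightarrow> complex fls" by (rule ring_morphism_fps_to_fls)
  obtain y where y: "qval T m y = 0" "(y - T (Suc m)) $ 0 = 0" using exists_special_root by blast
  have "poly (map_poly to_ac (poly_to_K (qpoly c m))) b = 0"
    using b by (simp add: qval_map_poly_hom[OF ring_morphism_to_ac] qroots_def)
  moreover have "poly (map_poly (place \<tau>) (poly_to_K (qpoly c m))) (fps_to_fls y) = 0"
    using y(1) by (simp add: qval_map_poly_hom[OF ring_morphism_place] place_to_K flip: fl.qval_hom)
  \<comment> \<open>Irreducibility is what allows the given root \<open>b\<close> to be sent to the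
    special root \<open>y\<close>.\<close>
  ultimately obtain F0 \<phi>0 where F0: "subfield_set F0" "hom_on F0 \<phi>0" "range to_ac \<subseteq> F0" "b \<in> F0"
    "\<phi>0 b = fps_to_fls y" "\<And>x. \<phi>0 (to_ac x) = place \<tau> x"
    using hom_on_simple_ext[OF ring_morphism_to_ac ring_morphism_place irr] by metis
  have toF0: "to_ac x \<in> F0" for x using F0(3) by blast
  have root_image: "qval T k z = 0"
    if "subfield_set F" "hom_on F \<phi>" "range to_ac \<subseteq> F" "\<And>x. \<phi> (to_ac x) = place \<tau> x"
      "x \<in> F" "x \<in> qroots c k" "\<phi> x = fps_to_fls z" for F \<phi> k x z
  proof -
    have "\<phi> (qval (acK c) k x) = qval (\<lambda>i. \<phi> (acK c i)) k (\<phi> x)"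
      by (rule conjunct2[OF hom_on_qval[OF that(1,2,5)]]) (use that(3) in auto)
    then have "qval (\<lambda>i. fps_to_fls (T i)) k (fps_to_fls z) = 0"
      using that hom_on_0[OF that(1,2)] by (simp add: qroots_def place_to_K)
    then show ?thesis by (simp flip: fl.qval_hom)
  qed
  \<comment> \<open>The roots are adjoined level by level. Their images stay power series, not
    merely Laurent series, because each new square maps to a unit by
    \<open>unit_at_lower_root\<close>.\<close>
  have "\<exists>F \<phi>. subfield_set F \<and> hom_on F \<phi> \<and> F0 \<subseteq> F \<and> qroots c k \<subseteq> F \<and> (\<forall>x\<in>F0. \<phi> x = \<phi>0 x)
      \<and> (\<forall>x\<in>qroots c k. \<exists>z. \<phi> x = fps_to_fls z)" if "k \<le> m" for k
    using that
  proof (induction k)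
    case 0
    have "qroots c 0 = {0}" by (auto simp: qroots_def)
    then show ?case
      using F0 subfield_setD(2)[OF F0(1)] hom_on_0[OF F0(1,2)]
      by (intro exI[of _ F0] exI[of _ \<phi>0]) (auto intro: exI[of _ 0])
  next
    case (Suc k)
    then obtain F \<phi> where F: "subfield_set F" "hom_on F \<phi>" "F0 \<subseteq> F" "qroots c k \<subseteq> F"
      "\<forall>x\<in>F0. \<phi> x = \<phi>0 x" "\<forall>x\<in>qroots c k. \<exists>z. \<phi> x = fps_to_fls z" by auto
    have F': "range to_ac \<subseteq> F" "\<And>x. \<phi> (to_ac x) = place \<tau> x" using F(3,5) F0(3,6) toF0 by auto
    have sq: "a ^ 2 \<in> F \<and> (\<exists>l. \<phi> (a ^ 2) = fps_to_fls l ^ 2)" if "a \<in> qroots c (Suc k)" for a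
    proof -
      define x where "x = a ^ 2 + acK c (Suc k)"
      have x: "x \<in> qroots c k" "x \<in> F" "acK c (Suc k) \<in> F" using that F F' by (auto simp: qroots_def x_def)
      then obtain z where z: "\<phi> x = fps_to_fls z" using F by blast
      have "a ^ 2 = x - acK c (Suc k)" by (simp add: x_def)
      moreover have "\<phi> (x - acK c (Suc k)) = fps_to_fls (z - T (Suc k))"
        using hom_on_diff[OF F(1,2) x(2,3)] by (simp add: z F' place_to_K)
      moreover have "(z - T (Suc k)) $ 0 \<noteq> 0"
        using root_image[OF F(1,2) F' x(2,1) z] unit_at_lower_root Suc.prems by simp
      then obtain l where "l ^ 2 = z - T (Suc k)"
        using fps_sqrt_exists[of _ "csqrt ((z - T (Suc k)) $ 0)"] by (metis power2_csqrt)
      ultimately show ?thesis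
        using x subfield_setD(3)[OF F(1)] by (metis fps_to_fls_power)
    qed
    obtain F1 \<phi>1 where F1: "subfield_set F1" "hom_on F1 \<phi>1" "F \<subseteq> F1" "qroots c (Suc k) \<subseteq> F1"
      "\<And>x. x \<in> F \<Longrightarrow> \<phi>1 x = \<phi> x"
      using hom_on_adjoin_sqrts[OF finite_qroots[of c "Suc k"] F(1,2)] sq by metis
    have "\<exists>z. \<phi>1 a = fps_to_fls z" if a: "a \<in> qroots c (Suc k)" for a
    proof -
      from sq[OF a] obtain l where l: "a ^ 2 \<in> F" "\<phi> (a ^ 2) = fps_to_fls l ^ 2" by blast
      have "\<phi>1 a ^ 2 = fps_to_fls l ^ 2"
        using hom_on_power[OF F1(1,2), of a 2] F1(4,5) a l by auto
      then have "\<phi>1 a = fps_to_fls l \<or> \<phi>1 a = fps_to_fls (- l)" by (simp add: power2_eq_iff)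
      then show ?thesis by blast
    qed
    then show ?case using F F1 by (intro exI[of _ F1] exI[of _ \<phi>1]) auto
  qed
  then obtain F \<phi> where F: "subfield_set F" "hom_on F \<phi>" "F0 \<subseteq> F" "qroots c m \<subseteq> F"
      "\<forall>x\<in>F0. \<phi> x = \<phi>0 x" "\<forall>x\<in>qroots c m. \<exists>z. \<phi> x = fps_to_fls z" by blast
  have F': "range to_ac \<subseteq> F" "\<And>x. \<phi> (to_ac x) = place \<tau> x" using F(3,5) F0(3,6) toF0 by auto
  have img: "x - acK c (Suc m) \<in> F \<and> \<phi> (x - acK c (Suc m)) = \<phi> x - fps_to_fls (T (Suc m))"
    if "x \<in> qroots c m" for x
  proof -
    have "x \<in> F" "acK c (Suc m) \<in> F" using that F F' by auto
    then show ?thesis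
      using hom_on_diff[OF F(1,2)] subfield_setD(3)[OF F(1)] by (simp add: F' place_to_K)
  qed
  have sq: "a ^ 2 \<in> F \<and> (\<exists>l. l ^ 2 = \<phi> (a ^ 2))" if "a \<in> \<alpha> ` (qroots c m - {b})" for a
  proof -
    from that obtain x where x: "x \<in> qroots c m" "x \<noteq> b" "a = \<alpha> x" by blast
    then obtain z where z: "\<phi> x = fps_to_fls z" using F by blast
    have "x \<in> F" using x F by blast
    \<comment> \<open>Morphisms of fields are injective, so a root other than \<open>b\<close>
      cannot also go to \<open>y\<close>.\<close>
    have "z \<noteq> y"
    proof
      assume "z = y"
      then have "\<phi> (x - b) = 0"
        using hom_on_diff[OF F(1,2) \<open>x \<in> F\<close>, of b] F0 F z by auto
      then show False
        using hom_on_eq_0[OF F(1,2), of "x - b"] subfield_setD(3)[OF F(1) \<open>x \<in> F\<close>, of b] F0 F x(2) by auto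
    qed
    then have "(z - T (Suc m)) $ 0 \<noteq> 0"
      using root_image[OF F(1,2) F' \<open>x \<in> F\<close> x(1) z] unit_at_other_root[OF y] by simp
    then obtain l where "l ^ 2 = z - T (Suc m)"
      using fps_sqrt_exists[of _ "csqrt ((z - T (Suc m)) $ 0)"] by (metis power2_csqrt)
    then have "fps_to_fls l ^ 2 = \<phi> (a ^ 2)"
      using x img[OF x(1)] \<alpha>[OF x(1)] z by (simp flip: fps_to_fls_power)
    then show ?thesis using img[OF x(1)] \<alpha>[OF x(1)] x(3) by auto
  qed
  obtain F1 \<phi>1 where F1: "subfield_set F1" "hom_on F1 \<phi>1" "F \<subseteq> F1" "\<alpha> ` (qroots c m - {b}) \<subseteq> F1"
    "\<And>x. x \<in> F \<Longrightarrow> \<phi>1 x = \<phi> x"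
    using hom_on_adjoin_sqrts[OF _ F(1,2), of "\<alpha> ` (qroots c m - {b})"] sq finite_qroots[of c m] by (metis finite_Diff finite_imageI)
  have "\<alpha> b \<notin> F1"
  proof
    assume "\<alpha> b \<in> F1"
    then have "\<phi>1 (\<alpha> b) ^ 2 = \<phi>1 (b - acK c (Suc m))"
      using hom_on_power[OF F1(1,2), of "\<alpha> b" 2] \<alpha>[OF b] by simp
    also have "\<dots> = fps_to_fls (y - T (Suc m))"
      using img[OF b] F1(5) F0 F by auto
    finally show False
      using fps_to_fls_not_square[OF y(2) special_root_valuation[OF y]] by blast
  qed
  then show ?thesis
    using F1(1,4) subset_trans[OF F'(1) F1(3)] subset_trans[OF F(4) F1(3)] by (intro exI[of _ F1] conjI)
qed

end

section \<open>Degrees of splitting fields\<close>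

interpretation type_ring: ring "ring_of_type_algebra :: 'a::field ring"
  by (rule ring_from_type_algebra)

lemmas type_field_subfieldI = field.subfieldI'[OF field_from_type_algebra]
  and type_field_generate_subfield = field.generate_field_is_subfield[OF field_from_type_algebra]
  and type_field_generate_min = field.generate_field_min_subfield1[OF field_from_type_algebra]

lemma ring_of_type_algebra_simps [simp]:
  "carrier (ring_of_type_algebra :: 'a::field ring) = UNIV"
  "(\<zero>\<^bsub>ring_of_type_algebra\<^esub> :: 'a) = 0"
  "(\<one>\<^bsub>ring_of_type_algebra\<^esub> :: 'a) = 1"
  "x \<oplus>\<^bsub>ring_of_type_algebra\<^esub> y = (x + y :: 'a)"
  "x \<otimes>\<^bsub>ring_of_type_algebra\<^esub> y = (x * y :: 'a)"
  by (simp_all add: ring_of_type_algebra_def)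

lemma a_inv_ring_of_type_algebra [simp]:
  "\<ominus>\<^bsub>ring_of_type_algebra\<^esub> x = (- x :: 'a::field)"
  by (rule type_ring.minus_equality) simp_all

lemma inv_ring_of_type_algebra [simp]:
  "x \<noteq> 0 \<Longrightarrow> inv\<^bsub>ring_of_type_algebra\<^esub> x = inverse (x :: 'a::field)"
  by (rule comm_monoid.comm_inv_char[OF cring.axioms(2)[OF cring_from_type_algebra]]) simp_all

lemma subfield_iff_subfield_set:
  "subfield F ring_of_type_algebra \<longleftrightarrow> subfield_set (F :: 'a::field set)"
proof
  assume F: "subfield F ring_of_type_algebra"
  note R = subringE[OF subfieldE(1)[OF F]]
  have neg: "- x \<in> F" if "x \<in> F" for x using R(5)[of x] that by simp
  have z: "0 \<in> F" "1 \<in> F" using R(2,3) by simp_all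
  have "inverse x \<in> F" if "x \<in> F" for x
    using type_ring.subfield_m_inv(1)[OF F, of x] that z by (cases "x = 0") auto
  moreover have "x - y \<in> F" "x * y \<in> F" if "x \<in> F" "y \<in> F" for x y
    using R(6)[of x y] R(7)[of x "- y"] neg[of y] that by simp_all
  ultimately show "subfield_set F" using z by (simp add: subfield_set_def)
next
  assume F: "subfield_set F"
  note D = subfield_setD[OF F]
  show "subfield F ring_of_type_algebra"
  proof (rule type_field_subfieldI)
    show "subring F ring_of_type_algebra"
      by (rule type_ring.subringI) (use D in auto)
  qed (use D in auto)
qed

lemma dimension_sqrt_ext:
  fixes F :: "'a::field set"
  assumes F: "subfield_set F" and "a \<notin> F"
  shows "ring.dimension ring_of_type_algebra 2 F (sqrt_ext F a)"
proof -
  have "ring.dimension ring_of_type_algebra 1 F F"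
    using type_ring.dimension_one F by (simp add: subfield_iff_subfield_set)
  then have "ring.dimension ring_of_type_algebra (Suc 1) F
      (ring.line_extension ring_of_type_algebra F a F)"
    using \<open>a \<notin> F\<close> by (intro type_ring.Suc_dim) auto
  moreover have "ring.line_extension ring_of_type_algebra F a F = sqrt_ext F a"
    by (auto simp: sqrt_ext_def type_ring.line_extension_mem_iff) (metis add.commute)+
  ultimately show ?thesis by (simp add: numeral_2_eq_2)
qed

text \<open>Each element has its square in \<open>F\<close> but lies outside the field generated by
  its predecessors, so every adjunction doubles the degree.\<close>

lemma dimension_tower:
  fixes F :: "'a::field set" and as :: "'a list"
  assumes F: "subfield_set F" and sq: "\<And>a. a \<in> set as \<Longrightarrow> a ^ 2 \<in> F"
    and notin: "\<And>a bs cs. as = bs @ a # cs \<Longrightarrow> a \<notin> foldl sqrt_ext F bs"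
  shows "subfield_set (foldl sqrt_ext F as) \<and> F \<subseteq> foldl sqrt_ext F as \<and> set as \<subseteq> foldl sqrt_ext F as
    \<and> ring.dimension ring_of_type_algebra (2 ^ length as) F (foldl sqrt_ext F as)"
  using sq notin
proof (induction as rule: rev_induct)
  case Nil
  have "ring.dimension ring_of_type_algebra 1 F F"
    using type_ring.dimension_one F by (simp add: subfield_iff_subfield_set)
  then show ?case using F by simp
next
  case (snoc a as)
  have IH: "subfield_set (foldl sqrt_ext F as)" "F \<subseteq> foldl sqrt_ext F as" "set as \<subseteq> foldl sqrt_ext F as"
    "ring.dimension ring_of_type_algebra (2 ^ length as) F (foldl sqrt_ext F as)"
    using snoc by auto
  have a: "a ^ 2 \<in> foldl sqrt_ext F as" "a \<notin> foldl sqrt_ext F as"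
    using snoc.prems(1)[of a] snoc.prems(2)[of as a "[]"] IH(2) by auto
  have "ring.dimension ring_of_type_algebra (2 ^ length as * 2) F (sqrt_ext (foldl sqrt_ext F as) a)"
    using IH(1) F dimension_sqrt_ext[OF IH(1) a(2)]
    by (intro type_ring.telescopic_base[OF _ _ IH(4)]) (simp_all add: subfield_iff_subfield_set)
  then show ?case
    using subfield_set_sqrt_ext[OF IH(1) a(1)] sqrt_ext_base[OF IH(1), of a] IH(2,3)
    by (auto simp: mult.commute)
qed

lemma foldl_sqrt_ext_subset:
  assumes "subfield_set F'" "F \<subseteq> F'" "set as \<subseteq> F'"
  shows "foldl sqrt_ext F as \<subseteq> F'"
  using assms(2,3) by (induction as rule: rev_induct) (auto dest: sqrt_ext_subset[OF assms(1)])

lemma splitting_field_poly_to_K: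
  "splitting_field (poly_to_K (qpoly c n)) = generate_field ring_of_type_algebra (range to_ac \<union> qroots c n)"
  by (simp add: splitting_field_def qroots_def qval_map_poly_hom[OF ring_morphism_to_ac])

lemma subfield_set_generate_field:
  "subfield_set (generate_field ring_of_type_algebra (A :: 'a::field set))"
  using type_field_generate_subfield[of A] by (simp add: subfield_iff_subfield_set)

lemma generate_field_subset:
  assumes "subfield_set F" "A \<subseteq> F"
  shows "generate_field ring_of_type_algebra A \<subseteq> F"
  using type_field_generate_min[of A F] assms by (simp add: subfield_iff_subfield_set)

text \<open>Above a root \<open>x\<close> of one level lie exactly two roots of the next, unless
  \<open>x\<close> equals the constant \<open>c (Suc n)\<close>; in that case 0 would be a root and
  \<open>qval c (Suc n) 0\<close> would vanish.\<close>

lemma card_qroots: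
  assumes "\<And>j. 1 \<le> j \<Longrightarrow> j \<le> n \<Longrightarrow> qval c j 0 \<noteq> 0"
  shows "card (qroots c n) = 2 ^ n"
  using assms
proof (induction n)
  case 0
  have "qroots c 0 = {0}" by (auto simp: qroots_def)
  then show ?case by simp
next
  case (Suc n)
  define f where "f x = x ^ 2 + acK c (Suc n)" for x
  have fib: "card {a. f a = x} = 2" if "x \<in> qroots c n" for x
  proof -
    obtain a where a: "a ^ 2 = x - acK c (Suc n)"
      using nth_root_exists[of 2 "x - acK c (Suc n)"] by auto
    have "a \<noteq> 0"
    proof
      assume "a = 0"
      then have "qval (acK c) (Suc n) 0 = 0" using a that by (simp add: qroots_def)
      moreover have "to_ac (to_K (qval c (Suc n) 0)) = qval (acK c) (Suc n) 0"
        using ring_morphism.qval_hom[OF ring_morphism.comp[OF ring_morphism_to_K ring_morphism_to_ac], of c "Suc n" 0]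
        by (simp add: to_K_def)
      ultimately show False using Suc.prems[of "Suc n"] by simp
    qed
    have "f y = x \<longleftrightarrow> y ^ 2 = a ^ 2" for y by (auto simp: f_def a)
    then have "{y. f y = x} = {a, - a}" by (auto simp: power2_eq_iff)
    moreover have "a \<noteq> - a" using \<open>a \<noteq> 0\<close> by (simp add: eq_neg_iff_add_eq_0)
    ultimately show ?thesis by simp
  qed
  have "qroots c (Suc n) = (\<Union>x\<in>qroots c n. {a. f a = x})"
    by (auto simp: qroots_def f_def)
  then have "card (qroots c (Suc n)) = (\<Sum>x\<in>qroots c n. card {a. f a = x})"
    using finite_qroots[of c n] fib by (simp only:) (intro card_UN_disjoint, auto intro: card_ge_0_finite)
  also have "\<dots> = 2 ^ Suc n" using fib Suc by simp
  finally show ?case .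
qed

context ramified_place
begin

text \<open>The \<open>2 ^ m\<close> square roots \<open>\<alpha> x\<close> generate the next
  splitting field. Adjoined one after another, each doubles the degree, since
  \<open>sqrt_not_in_extension\<close> separates it from all the others.\<close>

lemma dimension_step:
  assumes irr: "irreducible (poly_to_K (qpoly c m))"
  shows "ring.dimension ring_of_type_algebra (2 ^ (2 ^ m))
    (splitting_field (poly_to_K (qpoly c m))) (splitting_field (poly_to_K (qpoly c (Suc m))))"
proof -
  define G where "G n = generate_field ring_of_type_algebra (range to_ac \<union> qroots c n)" for n
  have G: "subfield_set (G n)" "range to_ac \<union> qroots c n \<subseteq> G n" for n
    unfolding G_def by (rule subfield_set_generate_field) (auto intro: generate_field.incl)
  have "\<exists>a. a ^ 2 = x - acK c (Suc m)" for x :: "Qt alg_closure"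
    using nth_root_exists[of 2 "x - acK c (Suc m)"] by auto
  then obtain \<alpha> where \<alpha>: "\<And>x. \<alpha> x ^ 2 = x - acK c (Suc m)" by metis
  have inj: "inj \<alpha>" by (rule injI) (metis \<alpha> diff_eq_diff_eq eq_iff_diff_eq_0 diff_add_cancel)
  obtain xs where xs: "set xs = qroots c m" "distinct xs"
    using finite_distinct_list[OF finite_qroots] by blast
  define as where "as = map \<alpha> xs"
  have "qval c j 0 \<noteq> 0" if "1 \<le> j" "j \<le> m" for j
    using nonzero[OF that] by (metis map_poly_0 poly_0)
  then have len: "length as = 2 ^ m"
    using distinct_card[OF xs(2)] card_qroots[of m c] by (simp add: as_def xs(1))
  have tower: "subfield_set (foldl sqrt_ext (G m) as) \<and> G m \<subseteq> foldl sqrt_ext (G m) as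
    \<and> set as \<subseteq> foldl sqrt_ext (G m) as
    \<and> ring.dimension ring_of_type_algebra (2 ^ length as) (G m) (foldl sqrt_ext (G m) as)"
  proof (rule dimension_tower[OF G(1)])
    fix a assume "a \<in> set as"
    then obtain x where "x \<in> qroots c m" "a = \<alpha> x" by (auto simp: as_def xs)
    moreover have "x \<in> G m" "acK c (Suc m) \<in> G m" using G(2)[of m] \<open>x \<in> qroots c m\<close> by auto
    ultimately show "a ^ 2 \<in> G m" using subfield_setD(3)[OF G(1)] by (simp add: \<alpha>)
  next
    fix a bs cs assume eq: "as = bs @ a # cs"
    then obtain ys b zs where xs': "xs = ys @ b # zs" "bs = map \<alpha> ys" "a = \<alpha> b"
      unfolding as_def by (auto simp: map_eq_append_conv map_eq_Cons_conv)
    have "b \<in> qroots c m" using xs xs' by auto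
    then obtain F where F: "subfield_set F" "range to_ac \<subseteq> F" "qroots c m \<subseteq> F"
      "\<alpha> ` (qroots c m - {b}) \<subseteq> F" "\<alpha> b \<notin> F"
      using sqrt_not_in_extension[OF irr, of b \<alpha>] \<alpha> by metis
    have "G m \<subseteq> F" unfolding G_def using F by (intro generate_field_subset) auto
    \<comment> \<open>As the list is distinct, \<open>b\<close> is not among its predecessors, whose
      square roots therefore all lie in \<open>F\<close>.\<close>
    moreover have "set ys \<subseteq> qroots c m - {b}" using xs xs'(1) by auto
    then have "set bs \<subseteq> F" using F(4) by (auto simp: xs'(2))
    ultimately show "a \<notin> foldl sqrt_ext (G m) bs"
      using foldl_sqrt_ext_subset[OF F(1)] F(5) xs'(3) by blast
  qed
  have root_iff: "a \<in> qroots c (Suc m) \<longleftrightarrow> a ^ 2 + acK c (Suc m) \<in> qroots c m" for a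
    by (simp add: qroots_def)
  have "foldl sqrt_ext (G m) as = G (Suc m)"
  proof
    have c: "acK c (Suc m) \<in> G (Suc m)" using G(2)[of "Suc m"] by auto
    have \<alpha>_mem: "\<alpha> x \<in> G (Suc m)" if "x \<in> qroots c m" for x
      using root_iff[of "\<alpha> x"] that G(2)[of "Suc m"] by (auto simp: \<alpha>)
    have "x \<in> G (Suc m)" if "x \<in> qroots c m" for x
    proof -
      have "\<alpha> x ^ 2 + acK c (Suc m) \<in> G (Suc m)"
        using \<alpha>_mem[OF that] c by (intro subfield_setD[OF G(1)])
      then show ?thesis by (simp add: \<alpha>)
    qed
    then have "G m \<subseteq> G (Suc m)"
      unfolding G_def[of m] using G[of "Suc m"] by (intro generate_field_subset) auto
    then show "foldl sqrt_ext (G m) as \<subseteq> G (Suc m)"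
      using \<alpha>_mem by (intro foldl_sqrt_ext_subset G(1)) (auto simp: as_def xs)
  next
    have "a \<in> foldl sqrt_ext (G m) as" if "a \<in> qroots c (Suc m)" for a
    proof -
      define x where "x = a ^ 2 + acK c (Suc m)"
      have "x \<in> qroots c m" using that by (simp add: root_iff x_def)
      then have "\<alpha> x \<in> foldl sqrt_ext (G m) as" using tower by (auto simp: as_def xs)
      moreover have "a ^ 2 = \<alpha> x ^ 2" by (simp add: \<alpha> x_def)
      then have "a = \<alpha> x \<or> a = - \<alpha> x" by (simp add: power2_eq_iff)
      ultimately show ?thesis using subfield_setD(6)[of "foldl sqrt_ext (G m) as"] tower by auto
    qed
    then show "G (Suc m) \<subseteq> foldl sqrt_ext (G m) as"
      unfolding G_def[of "Suc m"] using tower G(2)[of m] by (intro generate_field_subset) auto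
  qed
  then show ?thesis using tower len by (simp add: splitting_field_poly_to_K G_def del: qpoly_Suc)
qed

end

section \<open>Simple roots of the critical orbit\<close>

text \<open>Modulo 2 the factor \<open>g\<close> keeps its positive degree and \<open>k\<close> is
  nonzero, so the product is not constant there. Hence a polynomial congruent to 1 modulo 2 has no
  divisor like \<open>g\<close>.\<close>

lemma odd_coeff_mult_high:
  fixes g k :: "int poly"
  assumes "odd (lead_coeff g)" "degree g > 0" and "\<exists>i. odd (coeff k i)"
  shows "\<exists>i>0. odd (coeff (g * k) i)"
proof -
  let ?r = "map_poly (of_int :: int \<Rightarrow> bit)"
  interpret r: ring_morphism "of_int :: int \<Rightarrow> bit" by (rule ring_morphism_of_int)
  obtain i where "odd (coeff k i)" using assms(3) by blast
  then have k: "?r k \<noteq> 0" by (auto simp: poly_eq_iff coeff_map_poly of_int_bit intro!: exI[of _ i])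
  have dg: "degree (?r g) = degree g"
    using assms(1) by (intro map_poly_degree_eq) (simp add: of_int_bit)
  then have "?r g \<noteq> 0" using assms(2) by auto
  then have "degree (?r (g * k)) > 0"
    using k dg assms(2) by (simp add: r.map_poly_mult degree_mult_eq)
  moreover have "coeff (?r (g * k)) (degree (?r (g * k))) \<noteq> 0"
    using calculation by (metis degree_0 leading_coeff_0_iff less_irrefl)
  ultimately show ?thesis
    by (intro exI[of _ "degree (?r (g * k))"]) (auto simp: coeff_map_poly of_int_bit split: if_splits)
qed

text \<open>Here \<open>p\<close> is a primitive minimal polynomial of \<tau>. Pseudo-division shows
  that it divides a nonzero integer multiple of \<open>f\<close>, and Gauss's lemma removes the
  factor.\<close>

lemma dvd_of_common_root:
  fixes p f :: "int poly" and \<tau> :: complex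
  assumes p: "p \<noteq> 0" "poly (map_poly of_int p) \<tau> = 0" "content p = 1"
    and min: "\<And>q. q \<noteq> 0 \<Longrightarrow> poly (map_poly of_int q) \<tau> = 0 \<Longrightarrow> degree p \<le> degree q"
    and f: "poly (map_poly of_int f) \<tau> = 0"
  shows "p dvd f"
proof -
  interpret i: ring_morphism "of_int :: int \<Rightarrow> complex" by (rule ring_morphism_of_int)
  obtain a q where aq: "a \<noteq> 0" "smult a f = p * q + pseudo_mod f p"
    and deg: "pseudo_mod f p = 0 \<or> degree (pseudo_mod f p) < degree p"
    using pseudo_mod[OF p(1), of f] by blast
  have "poly (map_poly of_int (smult a f)) \<tau> = (0 :: complex)"
    using f by (simp add: map_poly_smult)
  then have "poly (map_poly of_int (pseudo_mod f p)) \<tau> = 0"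
    by (simp add: aq(2) i.map_poly_add i.map_poly_mult p(2))
  then have "pseudo_mod f p = 0" using min[of "pseudo_mod f p"] deg leD by blast
  then have "p dvd smult a f" using aq by simp
  then have "fract_poly p dvd smult (to_fract a) (fract_poly f)"
    using fract_poly_dvd[of p "smult a f"] by simp
  then have "fract_poly p dvd fract_poly f" using aq(1) by (simp add: dvd_smult_iff)
  then show ?thesis using p(3) by (rule fract_poly_dvdD)
qed

text \<open>A multiple root would make the primitive minimal polynomial \<open>p\<close> of \<tau>
  divide both \<open>f\<close> and its derivative. As a divisor of \<open>f\<close> it has odd
  leading coefficient; but the derivative is 1 modulo 2 and has no nonconstant divisor of this
  kind.\<close>

lemma simple_roots_of_odd_derivative:
  fixes f :: "int poly" and \<tau> :: complex
  assumes lc: "odd (lead_coeff f)" and d0: "odd (coeff (pderiv f) 0)" and d: "\<And>i. i > 0 \<Longrightarrow> even (coeff (pderiv f) i)"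
    and root: "poly (map_poly of_int f) \<tau> = 0"
  shows "poly (map_poly of_int (pderiv f)) \<tau> \<noteq> 0"
proof
  assume root': "poly (map_poly of_int (pderiv f)) \<tau> = 0"
  let ?Z = "\<lambda>q :: int poly. q \<noteq> 0 \<and> poly (map_poly of_int q) \<tau> = 0"
  have "f \<noteq> 0" using lc by auto
  then obtain p0 where p0: "?Z p0" and min0: "\<And>q. ?Z q \<Longrightarrow> degree p0 \<le> degree q"
    using ex_has_least_nat[of ?Z f degree] root by blast
  define p where "p = primitive_part p0"
  have c: "content p0 \<noteq> 0" using p0 by simp
  have p0_eq: "p0 = smult (content p0) p" by (simp add: p_def content_times_primitive_part)
  have p: "p \<noteq> 0" "poly (map_poly of_int p) \<tau> = 0" "content p = 1" "degree p = degree p0"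
  proof -
    have "poly (map_poly of_int (smult (content p0) p)) \<tau> = 0" using p0 p0_eq by simp
    then show "poly (map_poly of_int p) \<tau> = 0" using c by (simp add: map_poly_smult)
  qed (use p0 in \<open>auto simp: p_def\<close>)
  have dvd: "p dvd f" "p dvd pderiv f"
    using dvd_of_common_root[OF p(1-3)] min0 p(4) root root' by auto
  then obtain g h where g: "f = p * g" and h: "pderiv f = p * h" by (meson dvdE)
  have "odd (lead_coeff p)" using lc by (simp add: g lead_coeff_mult)
  moreover have "degree p > 0"
  proof (rule ccontr)
    assume "\<not> degree p > 0"
    then obtain a where "p = [:a:]" by (auto elim: degree_eq_zeroE)
    then show False using p by (simp add: map_poly_pCons)
  qed
  moreover have "\<exists>i. odd (coeff h i)"
  proof (rule ccontr)
    assume "\<nexists>i. odd (coeff h i)"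
    then have "even (coeff (p * h) 0)" by (simp add: coeff_mult)
    then show False using d0 h by simp
  qed
  ultimately show False using odd_coeff_mult_high[of p h] d h by auto
qed

section \<open>Parity, degree and zeros of the critical orbit\<close>

lemma map_poly_of_int_pderiv:
  "map_poly of_int (pderiv p) = (pderiv (map_poly of_int p) :: 'a::{idom,ring_char_0} poly)"
  by (intro poly_eqI) (simp add: coeff_map_poly coeff_pderiv)

lemma pderiv_qval_parity:
  fixes c :: "nat \<Rightarrow> int poly"
  assumes "n \<ge> 1"
  shows "even (coeff (pderiv (qval c n x)) i) \<longleftrightarrow> even (coeff (pderiv (c 1)) i)"
proof -
  from assms obtain m where "n = Suc m" by (cases n) auto
  moreover define y where "y = qval (\<lambda>i. c (Suc i)) m x"
  ultimately have "qval c n x = y ^ 2 + c 1" by (simp only: qval_Suc_left)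
  then have "pderiv (qval c n x) = (y * pderiv y + y * pderiv y) + pderiv (c 1)"
    by (simp only: pderiv_add power2_eq_square pderiv_mult)
  then show ?thesis by (simp only: coeff_add) simp
qed

lemma coeff_square_top:
  fixes q :: "'a::comm_ring_1 poly"
  assumes "degree q \<le> e"
  shows "coeff (q ^ 2) (2 * e) = coeff q e ^ 2"
proof (cases "degree q = e")
  case True
  then show ?thesis using coeff_mult_degree_sum[of q q] by (simp add: power2_eq_square mult_2)
next
  case False
  then have "degree q < e" using assms by simp
  moreover have "degree (q ^ 2) < 2 * e"
    using degree_power_le[of q 2] \<open>degree q < e\<close> by linarith
  ultimately show ?thesis by (simp add: coeff_eq_0)
qed

text \<open>The value starts as \<open>c (Suc n)\<close> and is then squared \<open>n\<close> times.
  The constants added after a squaring have degree at most \<open>d\<close>, below the doubled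
  bound, so the parity of the top coefficient is inherited.\<close>

lemma degree_qval_0:
  fixes c :: "nat \<Rightarrow> int poly"
  assumes "\<And>i. degree (c i) \<le> d" and "d > 0"
  shows "degree (qval c (Suc n) 0) \<le> d * 2 ^ n"
    and "odd (coeff (c (Suc n)) d) \<Longrightarrow> odd (coeff (qval c (Suc n) 0) (d * 2 ^ n))"
proof -
  have "degree (qval c (Suc n) 0) \<le> d * 2 ^ n \<and>
    (odd (coeff (c (Suc n)) d) \<longrightarrow> odd (coeff (qval c (Suc n) 0) (d * 2 ^ n)))"
    using assms(1)
  proof (induction n arbitrary: c)
    case 0
    then show ?case by simp
  next
    case (Suc n)
    define q where "q = qval (\<lambda>i. c (Suc i)) (Suc n) 0"
    have eq: "qval c (Suc (Suc n)) 0 = q ^ 2 + c 1" by (simp only: qval_Suc_left q_def)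
    have q: "degree q \<le> d * 2 ^ n" "odd (coeff (c (Suc (Suc n))) d) \<longrightarrow> odd (coeff q (d * 2 ^ n))"
      using Suc.IH[of "\<lambda>i. c (Suc i)"] Suc.prems unfolding q_def by blast+
    have "d * 1 < d * 2 ^ Suc n"
      using \<open>d > 0\<close> one_less_power[of "2 :: nat" "Suc n"] by (intro mult_strict_left_mono) auto
    then have c1: "degree (c 1) < d * 2 ^ Suc n" using Suc.prems[of 1] by linarith
    have "degree (q ^ 2) \<le> d * 2 ^ Suc n"
      using degree_power_le[of q 2] q(1) by (simp add: mult.commute)
    then have "degree (q ^ 2 + c 1) \<le> d * 2 ^ Suc n"
      using c1 by (intro degree_add_le) auto
    moreover have "coeff (q ^ 2) (d * 2 ^ Suc n) = (coeff q (d * 2 ^ n)) ^ 2"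
      using coeff_square_top[OF q(1)] by (simp add: mult_ac)
    moreover have "coeff (c 1) (d * 2 ^ Suc n) = 0" using c1 by (rule coeff_eq_0)
    ultimately show ?case unfolding eq using q(2) by (simp add: power2_eq_square)
  qed
  then show "degree (qval c (Suc n) 0) \<le> d * 2 ^ n"
    and "odd (coeff (c (Suc n)) d) \<Longrightarrow> odd (coeff (qval c (Suc n) 0) (d * 2 ^ n))" by auto
qed

lemma card_simple_roots:
  fixes p :: "complex poly"
  assumes "p \<noteq> 0" and simple: "\<And>x. poly p x = 0 \<Longrightarrow> poly (pderiv p) x \<noteq> 0"
  shows "card {x. poly p x = 0} = degree p"
proof -
  have "rsquarefree p" using simple by (auto simp: rsquarefree_roots)
  then have "p = smult (lead_coeff p) (\<Prod>z | poly p z = 0. [:- z, 1:])"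
    by (rule complex_poly_decompose_rsquarefree[symmetric])
  then have "degree p = degree (\<Prod>z | poly p z = 0. [:- z, 1:])"
    using assms(1) by (metis degree_smult_eq leading_coeff_0_iff)
  also have "\<dots> = card {x. poly p x = 0}" by (subst degree_prod_eq_sum_degree) auto
  finally show ?thesis by simp
qed

text \<open>The value \<open>f\<close> has \<open>d * 2 ^ m\<close> distinct complex zeros, whereas
  the product of the earlier ones has degree at most \<open>d * (2 ^ m - 1)\<close>, so some zero of
  \<open>f\<close> is not shared.\<close>

lemma exists_ramified_place:
  fixes c :: "nat \<Rightarrow> int poly"
  assumes deg: "\<And>i. degree (c i) \<le> d" and "d > 0"
    and odd0: "odd (coeff (pderiv (c 1)) 0)" and even: "\<And>i. i > 0 \<Longrightarrow> even (coeff (pderiv (c 1)) i)"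
    and top: "odd (coeff (c (Suc m)) d)"
  shows "\<exists>\<tau>. ramified_place c \<tau> m"
proof -
  interpret i: ring_morphism "of_int :: int \<Rightarrow> complex" by (rule ring_morphism_of_int)
  define f where "f = qval c (Suc m) 0"
  define F where "F = (map_poly of_int f :: complex poly)"
  define P where "P j = (map_poly of_int (qval c j 0) :: complex poly)" for j
  have par: "odd (coeff (pderiv (qval c j 0)) 0)" "\<And>i. i > 0 \<Longrightarrow> even (coeff (pderiv (qval c j 0)) i)"
    if "j \<ge> 1" for j
    using pderiv_qval_parity[OF that, of c 0] odd0 even by auto
  have f: "degree f \<le> d * 2 ^ m" "odd (coeff f (d * 2 ^ m))"
    using degree_qval_0[where c = c and n = m, OF deg \<open>d > 0\<close>] top unfolding f_def by auto
  then have "degree f = d * 2 ^ m" by (metis dvd_0_right le_antisym le_degree)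
  then have lc: "odd (lead_coeff f)" and degF: "degree F = d * 2 ^ m"
    using f(2) by (auto simp: F_def degree_map_poly)
  then have "F \<noteq> 0" using \<open>d > 0\<close> by auto
  have simple: "poly (pderiv F) x \<noteq> 0" if "poly F x = 0" for x
    using simple_roots_of_odd_derivative[OF lc] par[of "Suc m"] that
    by (simp add: F_def f_def map_poly_of_int_pderiv del: qval.simps(2))
  have card: "card {x. poly F x = 0} = d * 2 ^ m"
    using card_simple_roots[OF \<open>F \<noteq> 0\<close> simple] degF by simp
  have Pnz: "P j \<noteq> 0" if "j \<ge> 1" for j
  proof
    assume "P j = 0"
    then have "qval c j 0 = 0" unfolding P_def by (simp only: map_poly_of_int_eq_0_iff)
    then show False using par(1)[OF that] by simp
  qed
  define Q where "Q = (\<Prod>j\<in>{1..m}. P j)"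
  have "Q \<noteq> 0" unfolding Q_def using Pnz by (subst prod_zero_iff) auto
  have "degree Q \<le> (\<Sum>j\<in>{1..m}. degree (P j))"
    unfolding Q_def by (intro degree_prod_sum_le[THEN order_trans]) (auto simp: o_def)
  also have "\<dots> \<le> (\<Sum>j\<in>{1..m}. d * 2 ^ (j - 1))"
  proof (rule sum_mono)
    fix j assume "j \<in> {1..m}"
    then obtain k where "j = Suc k" by (cases j) auto
    then show "degree (P j) \<le> d * 2 ^ (j - 1)"
      using degree_qval_0(1)[where c = c and n = k, OF deg \<open>d > 0\<close>] map_poly_degree_leq[of of_int "qval c j 0"]
      unfolding P_def by (metis diff_Suc_1 order_trans)
  qed
  also have "\<dots> < d * 2 ^ m"
  proof (induction m)
    case (Suc m)
    then show ?case by simp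
  qed (use \<open>d > 0\<close> in simp)
  finally have degQ: "degree Q < d * 2 ^ m" .
  have "\<exists>x. poly F x = 0 \<and> poly Q x \<noteq> 0"
  proof (rule ccontr)
    assume "\<not> ?thesis"
    then have "card {x. poly F x = 0} \<le> card {x. poly Q x = 0}"
      using poly_roots_finite[OF \<open>Q \<noteq> 0\<close>] by (intro card_mono) auto
    also have "\<dots> \<le> degree Q" using \<open>Q \<noteq> 0\<close> by (rule card_poly_roots_bound)
    finally show False using card degQ by simp
  qed
  then obtain x where x: "poly F x = 0" "poly Q x \<noteq> 0" by blast
  have "ramified_place c x m"
  proof
    show "poly (map_poly of_int (qval c (Suc m) 0)) x = 0" using x(1) by (simp add: F_def f_def)
    show "poly (pderiv (map_poly of_int (qval c (Suc m) 0))) x \<noteq> 0"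
      using simple[OF x(1)] by (simp add: F_def f_def)
    show "poly (map_poly of_int (qval c j 0)) x \<noteq> 0" if "1 \<le> j" "j \<le> m" for j
      using x(2) that unfolding Q_def poly_prod P_def by (subst (asm) prod_zero_iff) auto
  qed
  then show ?thesis ..
qed

text \<open>The bound \<open>n \<ge> 2\<close> makes \<open>n - 1\<close> positive, so that
  irreducibility of the preceding composition is available.\<close>

lemma stable_and_maximal_step:
  fixes c :: "nat \<Rightarrow> int poly"
  assumes deg: "\<And>i. degree (c i) \<le> d" and "d > 0"
    and odd0: "odd (coeff (pderiv (c 1)) 0)" and even: "\<And>i. i > 0 \<Longrightarrow> even (coeff (pderiv (c 1)) i)"
    and \<gamma>: "\<And>i. i \<ge> 1 \<Longrightarrow> \<gamma> i = quad (c i)"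
  shows "stable_over_K \<gamma>" and "n \<ge> 2 \<Longrightarrow> odd (coeff (c n) d) \<Longrightarrow> maximal_step \<gamma> n"
proof -
  have eq: "iter_comp \<gamma> n = qpoly c n" for n by (rule iter_comp_eq_qpoly) (rule \<gamma>)
  have "odd (coeff (c 1) 1)" using odd0 by (simp add: coeff_pderiv)
  then have irr: "irreducible (poly_to_K (qpoly c n))" if "n \<ge> 1" for n
    using irreducible_poly_to_K_qpoly that by blast
  then show "stable_over_K \<gamma>" by (simp add: stable_over_K_def eq)
  assume "n \<ge> 2" and top: "odd (coeff (c n) d)"
  then obtain m where m: "n = Suc m" "m \<ge> 1" by (cases n) auto
  obtain \<tau> where "ramified_place c \<tau> m"
    using exists_ramified_place[of c d m] assms top m by blast
  then interpret ramified_place c \<tau> m .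
  show "maximal_step \<gamma> n"
    unfolding maximal_step_def K_iter_def eq m(1) using dimension_step[OF irr[OF m(2)]]
    by (simp del: qpoly_Suc)
qed

section \<open>Positive measure\<close>

text \<open>As \<open>S\<close> is finite, the predicate holds on a finite union of cylinders, one
  for each admissible initial segment of length \<open>n\<close>.\<close>

lemma pred_finitely_determined:
  assumes "finite S" "space M = S" "sets M = Pow S"
    and dep: "\<And>\<gamma> \<gamma>'. (\<And>i. 1 \<le> i \<Longrightarrow> i \<le> n \<Longrightarrow> \<gamma> i = \<gamma>' i) \<Longrightarrow> P \<gamma> \<longleftrightarrow> P \<gamma>'"
  shows "Measurable.pred (seq_measure M) P"
proof -
  define R where "R = (\<lambda>\<gamma>. restrict \<gamma> {1..n}) ` {\<gamma> \<in> seq_space S. P \<gamma>}"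
  have "R \<subseteq> PiE {1..n} (\<lambda>_. S)"
    by (auto simp: R_def seq_space_def PiE_iff extensional_def restrict_def)
  then have "finite R" using finite_PiE[of "{1..n}" "\<lambda>_. S"] \<open>finite S\<close> by (auto intro: finite_subset)
  have S: "f i \<in> S" if "f \<in> R" "i \<in> {1..n}" for f i
    using that \<open>R \<subseteq> _\<close> by (auto simp: PiE_iff)
  define cyl where "cyl f = prod_emb {1..} (\<lambda>_. M) {1..n} (PiE {1..n} (\<lambda>i. {f i}))" for f
  have cyl_iff: "\<gamma> \<in> cyl f \<longleftrightarrow> \<gamma> \<in> seq_space S \<and> (\<forall>i\<in>{1..n}. \<gamma> i = f i)" for \<gamma> f
    unfolding cyl_def prod_emb_def using assms(2)
    by (auto simp: seq_space_def space_PiM PiE_iff extensional_def restrict_def)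
  have "{\<gamma> \<in> space (seq_measure M). P \<gamma>} = (\<Union>f\<in>R. cyl f)"
  proof (intro equalityI subsetI)
    fix \<gamma> assume "\<gamma> \<in> {\<gamma> \<in> space (seq_measure M). P \<gamma>}"
    then have "\<gamma> \<in> seq_space S" "P \<gamma>" using assms(2) by (auto simp: seq_measure_def seq_space_def space_PiM)
    then show "\<gamma> \<in> (\<Union>f\<in>R. cyl f)" by (auto simp: cyl_iff R_def intro!: bexI[of _ \<gamma>])
  next
    fix \<gamma> assume "\<gamma> \<in> (\<Union>f\<in>R. cyl f)"
    then obtain \<gamma>' where "\<gamma>' \<in> seq_space S" "P \<gamma>'" "\<gamma> \<in> seq_space S" "\<And>i. i \<in> {1..n} \<Longrightarrow> \<gamma> i = \<gamma>' i"
      by (auto simp: cyl_iff R_def)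
    then show "\<gamma> \<in> {\<gamma> \<in> space (seq_measure M). P \<gamma>}"
      using dep[of \<gamma> \<gamma>'] assms(2) by (auto simp: seq_measure_def seq_space_def space_PiM)
  qed
  moreover have "cyl f \<in> sets (seq_measure M)" if "f \<in> R" for f
    unfolding cyl_def seq_measure_def using S[OF that] assms(3) by (intro sets_PiM_I) auto
  ultimately show ?thesis
    unfolding pred_def using \<open>finite R\<close> by (simp add: sets.finite_UN)
qed

text \<open>The set is a countable combination of conditions on finite initial segments. Its
  measurability permits comparing its measure with that of a subset.\<close>

lemma BigArb_measurable:
  assumes "finite S" "space M = S" "sets M = Pow S"
  shows "BigArb S \<in> sets (seq_measure M)"
proof -
  have irr [measurable]: "Measurable.pred (seq_measure M) (\<lambda>\<gamma>. Factorial_Ring.irreducible (poly_to_K (iter_comp \<gamma> n)))" for n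
  proof (rule pred_finitely_determined[OF assms, of n])
    fix \<gamma> \<gamma>' :: "nat \<Rightarrow> int poly poly"
    assume "\<And>i. 1 \<le> i \<Longrightarrow> i \<le> n \<Longrightarrow> \<gamma> i = \<gamma>' i"
    then have "iter_comp \<gamma> n = iter_comp \<gamma>' n" by (rule iter_comp_cong)
    then show "Factorial_Ring.irreducible (poly_to_K (iter_comp \<gamma> n))
      \<longleftrightarrow> Factorial_Ring.irreducible (poly_to_K (iter_comp \<gamma>' n))" by simp
  qed
  have max [measurable]: "Measurable.pred (seq_measure M) (\<lambda>\<gamma>. maximal_step \<gamma> n)" for n
  proof (rule pred_finitely_determined[OF assms, of n])
    fix \<gamma> \<gamma>' :: "nat \<Rightarrow> int poly poly"
    assume *: "\<And>i. 1 \<le> i \<Longrightarrow> i \<le> n \<Longrightarrow> \<gamma> i = \<gamma>' i"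
    then have "iter_comp \<gamma> n = iter_comp \<gamma>' n" by (rule iter_comp_cong)
    moreover from * have "iter_comp \<gamma> (n - 1) = iter_comp \<gamma>' (n - 1)"
      by (intro iter_comp_cong) auto
    ultimately show "maximal_step \<gamma> n \<longleftrightarrow> maximal_step \<gamma>' n"
      by (simp add: maximal_step_def K_iter_def)
  qed
  have "BigArb S = {\<gamma> \<in> space (seq_measure M). (\<forall>n. n \<ge> 1 \<longrightarrow> Factorial_Ring.irreducible (poly_to_K (iter_comp \<gamma> n)))
      \<and> (\<forall>m. \<exists>n. n \<ge> m \<and> n \<ge> 1 \<and> maximal_step \<gamma> n)}"
    using assms(2)
    by (auto simp: BigArb_def stable_over_K_def infinite_nat_iff_unbounded_le seq_measure_def seq_space_def space_PiM)
  also have "\<dots> \<in> sets (seq_measure M)"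
    by measurable
  finally show ?thesis .
qed

text \<open>Sequences that avoid \<open>\<theta>'\<close> from some index on form a null set, since
  avoiding it at \<open>L\<close> given places has probability \<open>(1 - p) ^ L\<close>. Only the
  condition on the first entry remains.\<close>

lemma measure_first_and_infinitely_often:
  fixes M :: "'a measure"
  assumes M: "strictly_positive_prob S M" and \<theta>: "\<theta> \<in> S" "\<theta>' \<in> S"
  defines "E \<equiv> {\<gamma> \<in> space (seq_measure M). \<gamma> 1 = \<theta> \<and> infinite {n. n \<ge> 1 \<and> \<gamma> n = \<theta>'}}"
  shows "E \<in> sets (seq_measure M)" and "measure (seq_measure M) E = measure M {\<theta>}"
proof -
  have P: "prob_space M" and sp: "space M = S" and st: "sets M = Pow S"
    and pos: "\<And>f. f \<in> S \<Longrightarrow> measure M {f} > 0"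
    using M by (auto simp: strictly_positive_prob_def)
  interpret M: prob_space M by (rule P)
  interpret PP: product_prob_space "\<lambda>_. M" "{1::nat..}" by unfold_locales
  let ?PM = "seq_measure M"
  have PM: "?PM = PiM {1..} (\<lambda>_. M)" by (simp add: seq_measure_def)
  interpret Q: prob_space ?PM unfolding PM by (rule PP.P.prob_space_axioms)
  have coord [measurable]: "Measurable.pred ?PM (\<lambda>\<gamma>. \<gamma> i = x)" if "i \<ge> 1" "x \<in> S" for i x
    unfolding PM pred_def using that st sp by (intro sets_Collect_single') auto
  define B where "B k = {\<gamma> \<in> space ?PM. \<forall>n. n \<ge> Suc k \<longrightarrow> \<gamma> n \<noteq> \<theta>'}" for k
  have B_sets [measurable]: "B k \<in> sets ?PM" for k
    unfolding B_def by (intro predE pred_intros_countable pred_intros_imp' pred_intros_logic coord) (use \<theta> in auto)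
  define A where "A = {\<gamma> \<in> space ?PM. \<gamma> 1 = \<theta>}"
  have A_sets: "A \<in> sets ?PM" unfolding A_def using coord[of 1 \<theta>] \<theta> by (simp add: pred_def)
  have E: "E = A - (\<Union>k. B k)"
    unfolding E_def A_def B_def infinite_nat_iff_unbounded_le
    by auto (metis Suc_le_eq le_trans Suc_leD Suc_le_mono le0 One_nat_def)+
  show "E \<in> sets ?PM" unfolding E using A_sets B_sets by auto
  define p where "p = measure M {\<theta>'}"
  have p: "p > 0" "p \<le> 1" using pos[OF \<theta>(2)] by (auto simp: p_def)
  have compl: "measure M (S - {\<theta>'}) = 1 - p"
    using M.prob_compl[of "{\<theta>'}"] \<theta> st sp by (simp add: p_def)
  have "measure ?PM (B k) = 0" for k
  proof -
    have bound: "measure ?PM (B k) \<le> (1 - p) ^ L" for L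
    proof -
      let ?J = "{Suc k..<Suc k + L}"
      have "B k \<subseteq> prod_emb {1..} (\<lambda>_. M) ?J (PiE ?J (\<lambda>_. S - {\<theta>'}))"
        unfolding B_def prod_emb_def PM by (auto simp: space_PiM PiE_iff sp extensional_def restrict_def)
      then have "measure ?PM (B k) \<le> measure ?PM (prod_emb {1..} (\<lambda>_. M) ?J (PiE ?J (\<lambda>_. S - {\<theta>'})))"
        unfolding PM using st by (intro PP.P.finite_measure_mono sets_PiM_I) auto
      also have "\<dots> = (\<Prod>i\<in>?J. measure M (S - {\<theta>'}))"
        unfolding PM using st by (intro PP.measure_PiM_emb) auto
      also have "\<dots> = (1 - p) ^ L" by (simp add: compl)
      finally show ?thesis .
    qed
    have "(\<lambda>L. (1 - p) ^ L) \<longlonglongrightarrow> 0" using p by (intro LIMSEQ_power_zero) auto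
    then have "measure ?PM (B k) \<le> 0" by (rule LIMSEQ_le_const) (use bound in auto)
    then show ?thesis by (simp add: measure_le_0_iff)
  qed
  then have "B k \<in> null_sets ?PM" for k
    using B_sets by (simp add: null_sets_def Q.emeasure_eq_measure)
  then have "(\<Union>k. B k) \<in> null_sets ?PM" by (rule null_sets_UN)
  then have "measure ?PM E = measure ?PM A"
    unfolding E using A_sets by (simp add: measure_Diff_null_set)
  also have "\<dots> = measure M {\<theta>}"
    using PP.emeasure_PiM_Collect_single[of 1 "{\<theta>}"] st \<theta> by (simp add: A_def PM measure_def)
  finally show "measure ?PM E = measure M {\<theta>}" .
qed

text \<open>A sequence with \<open>a\<close> in the first place and \<open>b\<close> infinitely
  often lies in \<open>BigArb S\<close>. The two elements may coincide.\<close>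

lemma measure_BigArb_pos:
  assumes M: "strictly_positive_prob S M" and fin: "finite C" and S: "S = quad ` C"
    and deg: "\<And>c. c \<in> C \<Longrightarrow> degree c \<le> d" and "d > 0"
    and a: "a \<in> C" "odd (coeff (pderiv a) 0)" "\<And>i. i > 0 \<Longrightarrow> even (coeff (pderiv a) i)"
    and b: "b \<in> C" "odd (coeff b d)"
  shows "measure (seq_measure M) (BigArb S) > 0"
proof -
  have fS: "finite S" using fin S by simp
  have sp: "space M = S" "sets M = Pow S" and P: "prob_space M"
    and pos: "measure M {quad a} > 0"
    using M a S by (auto simp: strictly_positive_prob_def)
  interpret Q: prob_space "seq_measure M"
    unfolding seq_measure_def by (rule prob_space_PiM) (rule P)
  define E where "E = {\<gamma> \<in> space (seq_measure M). \<gamma> 1 = quad a \<and> infinite {n. n \<ge> 1 \<and> \<gamma> n = quad b}}"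
  have E: "measure (seq_measure M) E = measure M {quad a}"
    unfolding E_def using measure_first_and_infinitely_often(2)[OF M] a(1) b(1) S by blast
  have "E \<subseteq> BigArb S"
  proof
    fix \<gamma> assume "\<gamma> \<in> E"
    then have \<gamma>: "\<gamma> \<in> seq_space S" "\<gamma> 1 = quad a" "infinite {n. n \<ge> 1 \<and> \<gamma> n = quad b}"
      by (auto simp: E_def seq_measure_def seq_space_def space_PiM sp)
    \<comment> \<open>Index 0 is outside the domain of \<open>\<gamma>\<close>; reading it as index
      1 makes every \<open>c i\<close> an element of \<open>C\<close>, as the degree bound is asked
      for all indices.\<close>
    define c where "c i = coeff (\<gamma> (max 1 i)) 0" for i
    have quad0: "coeff (quad x) 0 = x" for x by (simp add: quad_def)
    have mem: "\<gamma> i \<in> quad ` C" if "i \<ge> 1" for i using \<gamma>(1) that S by (auto simp: seq_space_def PiE_iff)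
    have c: "c i \<in> C" for i using mem[of "max 1 i"] by (auto simp: c_def quad0)
    have \<gamma>c: "\<gamma> i = quad (c i)" if "i \<ge> 1" for i using mem[OF that] that by (auto simp: c_def quad0 max_def)
    have c1: "c 1 = a" using \<gamma>(2) by (simp add: c_def quad0)
    note step = stable_and_maximal_step[of c d \<gamma>, OF deg[OF c] \<open>d > 0\<close>, unfolded c1, OF a(2,3) \<gamma>c]
    \<comment> \<open>Index 1 is dropped because maximality is known only from the second step on;
      removing it leaves an infinite set.\<close>
    have "{n. n \<ge> 1 \<and> \<gamma> n = quad b} - {1} \<subseteq> {n. n \<ge> 1 \<and> maximal_step \<gamma> n}"
    proof
      fix n assume n: "n \<in> {n. n \<ge> 1 \<and> \<gamma> n = quad b} - {1}"
      then have "c n = b" by (auto simp: c_def quad0 max_def)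
      then show "n \<in> {n. n \<ge> 1 \<and> maximal_step \<gamma> n}" using n step(2)[of n] b(2) by auto
    qed
    then have "infinite {n. n \<ge> 1 \<and> maximal_step \<gamma> n}"
      using \<gamma>(3) by (meson infinite_remove infinite_super)
    then show "\<gamma> \<in> BigArb S" using step(1) \<gamma>(1) by (simp add: BigArb_def)
  qed
  then have "measure (seq_measure M) E \<le> measure (seq_measure M) (BigArb S)"
    by (intro Q.finite_measure_mono BigArb_measurable fS sp)
  then show ?thesis using E pos by simp
qed

section \<open>Counting\<close>

text \<open>Both \<open>bounded_polys\<close> and its parity classes prescribe a range for each
  coefficient separately, so both are boxes of this form and their sizes are products.\<close>

definition coeff_box :: "nat \<Rightarrow> (nat \<Rightarrow> 'a::zero set) \<Rightarrow> 'a poly set"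
  where "coeff_box d E = {f. degree f \<le> d \<and> (\<forall>i\<le>d. coeff f i \<in> E i)}"

lemma bij_betw_coeff_box: "bij_betw (\<lambda>f. restrict (coeff f) {..d}) (coeff_box d E) (PiE {..d} E)"
proof (rule bij_betw_byWitness[where f' = "\<lambda>g. Poly (map g [0..<Suc d])"])
  have c: "coeff (Poly (map g [0..<Suc d])) i = (if i \<le> d then g i else 0)" for g :: "nat \<Rightarrow> 'a" and i
    by (simp add: nth_default_def del: upt_Suc)
  show "\<forall>f\<in>coeff_box d E. Poly (map (restrict (coeff f) {..d}) [0..<Suc d]) = f"
    unfolding poly_eq_iff c by (auto simp: coeff_box_def coeff_eq_0)
  show "\<forall>g\<in>PiE {..d} E. restrict (coeff (Poly (map g [0..<Suc d]))) {..d} = g"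
    unfolding c by (auto simp: PiE_iff extensional_def restrict_def fun_eq_iff)
  show "(\<lambda>f. restrict (coeff f) {..d}) ` coeff_box d E \<subseteq> PiE {..d} E"
    by (auto simp: coeff_box_def PiE_iff extensional_def split: if_splits)
  show "(\<lambda>g. Poly (map g [0..<Suc d])) ` PiE {..d} E \<subseteq> coeff_box d E"
  proof
    fix f assume "f \<in> (\<lambda>g. Poly (map g [0..<Suc d])) ` PiE {..d} E"
    then obtain g where g: "g \<in> PiE {..d} E" "f = Poly (map g [0..<Suc d])" by blast
    have "degree f \<le> d" unfolding g(2) by (rule degree_le) (simp only: c, simp)
    then show "f \<in> coeff_box d E" using g(1) unfolding coeff_box_def g(2) mem_Collect_eq c by (auto simp: PiE_iff)
  qed
qed

lemma finite_coeff_box: "(\<And>i. i \<le> d \<Longrightarrow> finite (E i)) \<Longrightarrow> finite (coeff_box d E)"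
  using bij_betw_finite[OF bij_betw_coeff_box[of d E]] finite_PiE[of "{..d}" E] by auto

lemma card_coeff_box: "card (coeff_box d E) = (\<Prod>i\<le>d. card (E i))"
  using bij_betw_same_card[OF bij_betw_coeff_box[of d E]] by (simp add: card_PiE)

lemma bounded_polys_eq_coeff_box: "bounded_polys d B = coeff_box d (\<lambda>_. {- int B..int B})"
proof -
  have "height f \<le> int B \<longleftrightarrow> (\<forall>i\<le>d. coeff f i \<in> {- int B..int B})" if "degree f \<le> d" for f
  proof -
    have "height f \<le> int B \<longleftrightarrow> (\<forall>i\<le>degree f. \<bar>coeff f i\<bar> \<le> int B)"
      by (auto simp: height_def)
    also have "\<dots> \<longleftrightarrow> (\<forall>i\<le>d. \<bar>coeff f i\<bar> \<le> int B)"
      using that by (metis abs_0 coeff_eq_0 not_le of_nat_0_le_iff order_trans)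
    finally show ?thesis by (simp add: abs_le_iff minus_le_iff) (meson minus_le_iff)
  qed
  then show ?thesis by (auto simp: bounded_polys_def coeff_box_def)
qed

lemma card_odd_interval: "card {x \<in> {- int B..int B}. odd x} = 2 * ((B + 1) div 2)"
proof (induction B)
  case 0
  have "{x \<in> {- int 0..int 0}. odd x} = {}" by auto
  then show ?case by simp
next
  case (Suc B)
  have "{x \<in> {- int (Suc B)..int (Suc B)}. odd x} =
    {x \<in> {- int B..int B}. odd x} \<union> (if even B then {- int (Suc B), int (Suc B)} else {})"
    by (auto simp: le_less)
  moreover have "card ({x \<in> {- int B..int B}. odd x} \<union> {- int (Suc B), int (Suc B)}) =
    card {x \<in> {- int B..int B}. odd x} + 2"
  proof -
    have "finite {x \<in> {- int B..int B}. odd x}" by (rule finite_subset[of _ "{- int B..int B}"]) auto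
    then show ?thesis by (subst card_Un_disjoint) auto
  qed
  ultimately show ?case using Suc by auto
qed

definition parity_set :: "bool option \<Rightarrow> nat \<Rightarrow> int set"
  where "parity_set p B = {x \<in> {- int B..int B}. case p of None \<Rightarrow> True | Some b \<Rightarrow> odd x = b}"

lemma finite_parity_set: "finite (parity_set p B)"
  by (rule finite_subset[of _ "{- int B..int B}"]) (auto simp: parity_set_def)

lemma parity_set_density:
  "(\<lambda>B. real (card (parity_set p B)) / real (2 * B + 1)) \<longlonglongrightarrow> (if p = None then 1 else 1 / 2)"
proof -
  have all: "card {- int B..int B} = 2 * B + 1" for B by simp
  have lim0: "(\<lambda>B. 1 / real (2 * B + 1)) \<longlonglongrightarrow> 0"
    by (rule LIMSEQ_subseq_LIMSEQ[OF lim_1_over_n, of "\<lambda>B. 2 * B + 1", unfolded o_def]) (simp add: strict_mono_def)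
  \<comment> \<open>Both parity counts lie between \<open>B\<close> and \<open>B + 1\<close> out of
    \<open>2 * B + 1\<close>, hence the proportions are within \<open>1 / (2 * B + 1)\<close> of one
    half.\<close>
  have half: "(\<lambda>B. real (k B) / real (2 * B + 1)) \<longlonglongrightarrow> 1 / 2"
    if "\<And>B. 2 * B \<le> 2 * k B \<and> 2 * k B \<le> 2 * B + 2" for k :: "nat \<Rightarrow> nat"
  proof (rule LIM_zero_cancel, rule tendsto_rabs_zero_cancel, rule tendsto_sandwich[OF _ _ tendsto_const lim0])
    show "\<forall>\<^sub>F B in sequentially. \<bar>real (k B) / real (2 * B + 1) - 1 / 2\<bar> \<le> 1 / real (2 * B + 1)"
    proof (rule always_eventually, rule allI)
      fix B
      have "\<bar>2 * real (k B) - (2 * real B + 1)\<bar> \<le> 1" using that[of B] by linarith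
      moreover have "real (k B) / real (2 * B + 1) - 1 / 2 = (2 * real (k B) - (2 * real B + 1)) / (2 * real (2 * B + 1))"
        by (simp add: field_simps)
      ultimately have "\<bar>real (k B) / real (2 * B + 1) - 1 / 2\<bar> \<le> 1 / (2 * real (2 * B + 1))"
        by (simp only: abs_divide) (intro frac_le, auto)
      also have "\<dots> \<le> 1 / real (2 * B + 1)" by (intro frac_le) auto
      finally show "\<bar>real (k B) / real (2 * B + 1) - 1 / 2\<bar> \<le> 1 / real (2 * B + 1)" .
    qed
  qed auto
  show ?thesis
  proof (cases p)
    case None
    have "parity_set p B = {- int B..int B}" for B
      by (auto simp: parity_set_def None)
    then have one: "real (card (parity_set p B)) / real (2 * B + 1) = 1" for B by simp
    show ?thesis unfolding one using None by simp
  next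
    case (Some b)
    have o: "card (parity_set (Some True) B) = 2 * ((B + 1) div 2)" for B
      using card_odd_interval[of B] by (simp add: parity_set_def)
    have sum: "card (parity_set (Some True) B) + card (parity_set (Some False) B) = 2 * B + 1" for B
    proof -
      have "parity_set (Some True) B \<union> parity_set (Some False) B = {- int B..int B}"
        "parity_set (Some True) B \<inter> parity_set (Some False) B = {}"
        by (auto simp: parity_set_def)
      then show ?thesis using all[of B] finite_parity_set by (metis card_Un_disjoint)
    qed
    have "2 * B \<le> 2 * card (parity_set p B) \<and> 2 * card (parity_set p B) \<le> 2 * B + 2" for B
    proof -
      have "B \<le> 2 * ((B + 1) div 2)" "2 * ((B + 1) div 2) \<le> B + 1" by presburger+
      then show ?thesis using o[of B] sum[of B] unfolding Some by (cases b) auto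
    qed
    then show ?thesis using half[of "\<lambda>B. card (parity_set p B)"] Some by simp
  qed
qed

section \<open>Densities of parity classes of polynomials\<close>

definition parity_box :: "nat \<Rightarrow> (nat \<Rightarrow> bool option) \<Rightarrow> nat \<Rightarrow> int poly set"
  where "parity_box d p B = coeff_box d (\<lambda>i. parity_set (p i) B)"

lemma finite_bounded_polys: "finite (bounded_polys d B)"
  unfolding bounded_polys_eq_coeff_box by (rule finite_coeff_box) auto

lemma card_bounded_polys: "card (bounded_polys d B) = (2 * B + 1) ^ Suc d"
proof -
  have "card {- int B..int B} = 2 * B + 1" by simp
  then show ?thesis unfolding bounded_polys_eq_coeff_box card_coeff_box by (simp only: prod_constant card_atMost)
qed

lemma card_bounded_polys_nonzero: "card (bounded_polys d B) \<noteq> 0"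
  unfolding card_bounded_polys by (rule power_not_zero) simp

lemma parity_box_subset: "parity_box d p B \<subseteq> bounded_polys d B"
  by (auto simp: parity_box_def bounded_polys_eq_coeff_box coeff_box_def parity_set_def)

lemma parity_box_density:
  "(\<lambda>B. real (card (parity_box d p B)) / real (card (bounded_polys d B)))
    \<longlonglongrightarrow> (1 / 2) ^ card {i. i \<le> d \<and> p i \<noteq> None}"
proof -
  have "(\<lambda>B. \<Prod>i\<le>d. real (card (parity_set (p i) B)) / real (2 * B + 1)) \<longlonglongrightarrow>
      (\<Prod>i\<le>d. if p i = None then 1 else 1 / 2)"
    by (intro tendsto_prod parity_set_density)
  moreover have "(\<Prod>i\<le>d. real (card (parity_set (p i) B)) / real (2 * B + 1)) =
      real (card (parity_box d p B)) / real (card (bounded_polys d B))" for B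
    unfolding card_bounded_polys parity_box_def card_coeff_box
    by (simp add: prod_dividef del: of_nat_Suc power_Suc)
  moreover have "(\<Prod>i\<le>d. if p i = None then 1 else 1 / 2) = (1 / 2 :: real) ^ card {i. i \<le> d \<and> p i \<noteq> None}"
  proof -
    have "{i. i \<le> d \<and> p i \<noteq> None} = {..d} \<inter> - {i. p i = None}" by auto
    then show ?thesis by (simp add: prod.If_cases)
  qed
  ultimately show ?thesis by simp
qed

text \<open>The quotient of binomial coefficients is the product of \<open>(x - i) / (y - i)\<close>
  over \<open>i < s\<close>, and each factor tends to \<rho>. If \<open>x < s\<close>, some
  numerator is 0, as is the binomial coefficient.\<close>

lemma binomial_ratio_tendsto:
  fixes x y :: "nat \<Rightarrow> nat"
  assumes y: "filterlim y at_top sequentially" and xy: "(\<lambda>n. real (x n) / real (y n)) \<longlonglongrightarrow> \<rho>"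
  shows "(\<lambda>n. real (x n choose s) / real (y n choose s)) \<longlonglongrightarrow> \<rho> ^ s"
proof -
  have ry: "filterlim (\<lambda>n. real (y n)) at_top sequentially"
    by (rule filterlim_compose[OF filterlim_real_sequentially y])
  have inv: "(\<lambda>n. real i / real (y n)) \<longlonglongrightarrow> 0" for i
    by (rule real_tendsto_divide_at_top[OF tendsto_const ry])
  have "(\<lambda>n. (real (x n) / real (y n) - real i / real (y n)) / (1 - real i / real (y n))) \<longlonglongrightarrow> (\<rho> - 0) / (1 - 0)" for i
    by (intro tendsto_divide tendsto_diff xy inv tendsto_const) simp
  then have "(\<lambda>n. \<Prod>i<s. (real (x n) / real (y n) - real i / real (y n)) / (1 - real i / real (y n)))
      \<longlonglongrightarrow> (\<Prod>i<s. \<rho>)"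
    by (intro tendsto_prod) simp
  moreover have "\<forall>\<^sub>F n in sequentially. (\<Prod>i<s. (real (x n) / real (y n) - real i / real (y n)) / (1 - real i / real (y n)))
      = real (x n choose s) / real (y n choose s)"
    using y[unfolded filterlim_at_top, rule_format, of "Suc s"]
  proof eventually_elim
    fix n assume n: "Suc s \<le> y n"
    have "(real (x n) / real (y n) - real i / real (y n)) / (1 - real i / real (y n)) =
        (real (x n) - real i) / (real (y n) - real i)" if "i < s" for i
      using n that by (simp add: divide_simps)
    then have "(\<Prod>i<s. (real (x n) / real (y n) - real i / real (y n)) / (1 - real i / real (y n))) =
        (\<Prod>i<s. (real (x n) - real i)) / (\<Prod>i<s. (real (y n) - real i))"
      by (simp add: prod_dividef)
    also have "\<dots> = real (x n choose s) / real (y n choose s)"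
      by (simp add: binomial_gbinomial gbinomial_prod_rev atLeast0LessThan)
    finally show "(\<Prod>i<s. (real (x n) / real (y n) - real i / real (y n)) / (1 - real i / real (y n)))
      = real (x n choose s) / real (y n choose s)" .
  qed
  ultimately show ?thesis using tendsto_cong by fastforce
qed

lemma bounded_polys_at_top: "filterlim (\<lambda>B. card (bounded_polys d B)) at_top sequentially"
proof (rule filterlim_at_top_mono[OF filterlim_ident])
  have "B \<le> card (bounded_polys d B)" for B
    using self_le_power[of "2 * B + 1" "Suc d"] unfolding card_bounded_polys by simp
  then show "\<forall>\<^sub>F B in sequentially. B \<le> card (bounded_polys d B)" by simp
qed

section \<open>Counting subsets that meet given sets\<close>

lemma card_subsets_avoiding:
  assumes "finite Y"
  shows "card {C. C \<subseteq> Y \<and> card C = s \<and> C \<inter> A = {}} = (card (Y - A) choose s)"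
proof -
  have "{C. C \<subseteq> Y \<and> card C = s \<and> C \<inter> A = {}} = {C. C \<subseteq> Y - A \<and> card C = s}" by auto
  then show ?thesis using n_subsets[of "Y - A" s] assms by simp
qed

text \<open>Inclusion-exclusion over the subsets that miss \<open>A\<close> or miss
  \<open>A'\<close>.\<close>

lemma card_subsets_meeting_both:
  assumes "finite Y"
  shows "real (card {C. C \<subseteq> Y \<and> card C = s \<and> C \<inter> A \<noteq> {} \<and> C \<inter> A' \<noteq> {}}) =
    real (card Y choose s) - real (card (Y - A) choose s) - real (card (Y - A') choose s)
    + real (card (Y - (A \<union> A')) choose s)"
proof -
  let ?T = "{C. C \<subseteq> Y \<and> card C = s}"
  let ?U = "\<lambda>A. {C. C \<subseteq> Y \<and> card C = s \<and> C \<inter> A = {}}"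
  have fin: "finite ?T" using assms by simp
  have finU: "finite (?U A)" for A by (rule finite_subset[OF _ fin]) auto
  have "{C. C \<subseteq> Y \<and> card C = s \<and> C \<inter> A \<noteq> {} \<and> C \<inter> A' \<noteq> {}} = ?T - (?U A \<union> ?U A')" by auto
  then have "card {C. C \<subseteq> Y \<and> card C = s \<and> C \<inter> A \<noteq> {} \<and> C \<inter> A' \<noteq> {}} = card ?T - card (?U A \<union> ?U A')"
    using finU by (simp only:) (intro card_Diff_subset, auto)
  moreover have "card (?U A \<union> ?U A') \<le> card ?T" using fin by (intro card_mono) auto
  moreover have "card (?U A) + card (?U A') = card (?U A \<union> ?U A') + card (?U A \<inter> ?U A')"
    by (rule card_Un_Int[OF finU finU])
  moreover have "?U A \<inter> ?U A' = ?U (A \<union> A')" by auto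
  moreover have "card ?T = (card Y choose s)" using n_subsets[OF assms] .
  ultimately show ?thesis using card_subsets_avoiding[OF assms, of s] by simp
qed

lemma inj_quad: "inj_on quad A"
  by (rule inj_onI) (simp add: quad_def)

lemma quad_sets_eq: "quad_sets d s B = image (image quad) {C. C \<subseteq> bounded_polys d B \<and> card C = s}"
  by (auto simp: quad_sets_def)

lemma card_image_quad: "card (image (image quad) Z) = card Z"
  by (intro card_image inj_on_subset[OF inj_on_image_Pow[of quad UNIV]]) (auto simp: inj_quad)

lemma complement_density:
  assumes "\<And>B. A B \<subseteq> bounded_polys d B"
    and "(\<lambda>B. real (card (A B)) / real (card (bounded_polys d B))) \<longlonglongrightarrow> a"
  shows "(\<lambda>B. real (card (bounded_polys d B - A B)) / real (card (bounded_polys d B))) \<longlonglongrightarrow> 1 - a"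
proof -
  have "real (card (bounded_polys d B - A B)) / real (card (bounded_polys d B)) =
      1 - real (card (A B)) / real (card (bounded_polys d B))" for B
  proof -
    have "card (bounded_polys d B - A B) = card (bounded_polys d B) - card (A B)"
      by (rule card_Diff_subset[OF finite_subset[OF assms(1) finite_bounded_polys] assms(1)])
    moreover have "card (A B) \<le> card (bounded_polys d B)"
      using assms(1) finite_bounded_polys by (intro card_mono)
    moreover have "card (bounded_polys d B) \<noteq> 0" by (rule card_bounded_polys_nonzero)
    ultimately show ?thesis by (simp add: of_nat_diff diff_divide_distrib)
  qed
  then show ?thesis using tendsto_diff[OF tendsto_const assms(2), of 1] by simp
qed

text \<open>A lower bound through sets that meet both \<open>A\<close> and \<open>A'\<close>. With
  \<open>A' = A\<close> the last two terms cancel, so one statement covers both the case of one kind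
  and that of two.\<close>

lemma liminf_proportion_ge:
  fixes Q :: "int poly poly set \<Rightarrow> bool"
  assumes A: "\<And>B. A B \<subseteq> bounded_polys d B" "\<And>B. A' B \<subseteq> bounded_polys d B"
    and lim: "(\<lambda>B. real (card (A B)) / real (card (bounded_polys d B))) \<longlonglongrightarrow> a"
      "(\<lambda>B. real (card (A' B)) / real (card (bounded_polys d B))) \<longlonglongrightarrow> a'"
      "(\<lambda>B. real (card (A B \<union> A' B)) / real (card (bounded_polys d B))) \<longlonglongrightarrow> u"
    and Q: "\<And>B C. C \<subseteq> bounded_polys d B \<Longrightarrow> card C = s \<Longrightarrow> C \<inter> A B \<noteq> {} \<Longrightarrow> C \<inter> A' B \<noteq> {} \<Longrightarrow> Q (quad ` C)"
  shows "liminf (\<lambda>B. ereal (real (card {S \<in> quad_sets d s B. Q S}) / real (card (quad_sets d s B))))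
    \<ge> ereal (1 - (1 - a) ^ s - (1 - a') ^ s + (1 - u) ^ s)"
proof -
  let ?Y = "bounded_polys d"
  \<comment> \<open>\<open>g B\<close> is the exact proportion of sets of constants that meet both
    classes.\<close>
  define g where "g B = (real (card (?Y B) choose s) - real (card (?Y B - A B) choose s)
    - real (card (?Y B - A' B) choose s) + real (card (?Y B - (A B \<union> A' B)) choose s)) / real (card (?Y B) choose s)" for B
  have "g B \<le> real (card {S \<in> quad_sets d s B. Q S}) / real (card (quad_sets d s B))" for B
  proof -
    let ?G = "{C. C \<subseteq> ?Y B \<and> card C = s \<and> C \<inter> A B \<noteq> {} \<and> C \<inter> A' B \<noteq> {}}"
    have "finite (quad_sets d s B)" unfolding quad_sets_eq using finite_bounded_polys by simp
    then have "card (image (image quad) ?G) \<le> card {S \<in> quad_sets d s B. Q S}"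
      using Q by (intro card_mono) (auto simp: quad_sets_eq)
    moreover have "card (quad_sets d s B) = (card (?Y B) choose s)"
      unfolding quad_sets_eq card_image_quad by (rule n_subsets[OF finite_bounded_polys])
    ultimately show ?thesis
      unfolding g_def card_subsets_meeting_both[OF finite_bounded_polys, symmetric]
      by (simp add: card_image_quad divide_right_mono)
  qed
  then have "liminf (\<lambda>B. ereal (g B)) \<le> liminf (\<lambda>B. ereal (real (card {S \<in> quad_sets d s B. Q S}) / real (card (quad_sets d s B))))"
    by (intro Liminf_mono always_eventually) simp
  moreover have "g \<longlonglongrightarrow> 1 - (1 - a) ^ s - (1 - a') ^ s + (1 - u) ^ s"
  proof -
    note R = binomial_ratio_tendsto[OF bounded_polys_at_top]
    have one: "(\<lambda>B. real (card (?Y B)) / real (card (?Y B))) \<longlonglongrightarrow> 1"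
      by (simp add: card_bounded_polys_nonzero)
    have "A B \<union> A' B \<subseteq> ?Y B" for B using A by auto
    note compl = complement_density[OF A(1) lim(1)] complement_density[OF A(2) lim(2)] complement_density[OF this lim(3)]
    have "(\<lambda>B. real (card (?Y B) choose s) / real (card (?Y B) choose s) - real (card (?Y B - A B) choose s) / real (card (?Y B) choose s)
      - real (card (?Y B - A' B) choose s) / real (card (?Y B) choose s) + real (card (?Y B - (A B \<union> A' B)) choose s) / real (card (?Y B) choose s))
      \<longlonglongrightarrow> 1 ^ s - (1 - a) ^ s - (1 - a') ^ s + (1 - u) ^ s"
      by (intro tendsto_add tendsto_diff R one compl)
    then show ?thesis by (simp add: g_def[abs_def] add_divide_distrib diff_divide_distrib)
  qed
  then have "liminf (\<lambda>B. ereal (g B)) = ereal (1 - (1 - a) ^ s - (1 - a') ^ s + (1 - u) ^ s)"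
    by (intro lim_imp_Liminf tendsto_ereal) simp
  ultimately show ?thesis by simp
qed

text \<open>The parities of coefficients that express \<open>c' \<equiv> 1\<close> modulo 2 and, for even \<open>d\<close>, an odd coefficient at \<open>t\<^sup>d\<close>;
  \<open>Some True\<close> stands for odd.\<close>

definition arb_first :: "nat \<Rightarrow> nat \<Rightarrow> bool option"
  where "arb_first d i = (if i = 1 then Some True else if odd i then Some False
    else if even d \<and> i = d then Some True else None)"

lemma card_odd_le: "card {i. i \<le> d \<and> odd i} = (d + 1) div 2"
proof (induction d)
  case 0
  have "{i :: nat. i \<le> 0 \<and> odd i} = {}" by (auto intro: odd_pos)
  then show ?case by simp
next
  case (Suc d)
  have "{i. i \<le> Suc d \<and> odd i} = {i. i \<le> d \<and> odd i} \<union> (if even d then {Suc d} else {})"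
    by (auto simp: le_Suc_eq)
  then show ?case using Suc by (auto simp: card_insert_if)
qed

text \<open>The constrained coefficients are those at the \<open>(d + 1) div 2\<close> odd
  exponents, together with the one at \<open>d\<close> when \<open>d\<close> is even.\<close>

lemma r_dens_eq:
  assumes "d > 0"
  shows "r_dens d = (1 / 2) ^ card {i. i \<le> d \<and> arb_first d i \<noteq> None}"
proof (cases "even d")
  case True
  then have "{i. i \<le> d \<and> arb_first d i \<noteq> None} = insert d {i. i \<le> d \<and> odd i}"
    by (auto simp: arb_first_def)
  then have "card {i. i \<le> d \<and> arb_first d i \<noteq> None} = Suc ((d + 1) div 2)"
    using True by (simp add: card_odd_le)
  then show ?thesis using True by (simp add: r_dens_def)
next
  case False
  then have "{i. i \<le> d \<and> arb_first d i \<noteq> None} = {i. i \<le> d \<and> odd i}"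
    by (auto simp: arb_first_def)
  then show ?thesis using False by (simp add: r_dens_def card_odd_le)
qed

text \<open>Coefficient \<open>i\<close> of the derivative is \<open>i + 1\<close> times
  \<open>coeff f (i + 1)\<close>: even for odd \<open>i\<close> in any case, and for even
  \<open>i > 0\<close> by the condition at odd exponents. The last clause makes the two kinds of
  constants disjoint when \<open>d > 1\<close> is odd.\<close>

lemma parity_box_arb_first:
  assumes "f \<in> parity_box d (arb_first d) B" "d > 0"
  shows "odd (coeff (pderiv f) 0)" "\<And>i. i > 0 \<Longrightarrow> even (coeff (pderiv f) i)" "even d \<Longrightarrow> odd (coeff f d)"
    and "d > 1 \<Longrightarrow> odd d \<Longrightarrow> even (coeff f d)"
proof -
  have mem: "coeff f i \<in> parity_set (arb_first d i) B" if "i \<le> d" for i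
    using assms that by (auto simp: parity_box_def coeff_box_def)
  have deg: "degree f \<le> d" using assms by (auto simp: parity_box_def coeff_box_def)
  show "odd (coeff (pderiv f) 0)"
    using mem[of 1] \<open>d > 0\<close> by (simp add: coeff_pderiv parity_set_def arb_first_def)
  show "even d \<Longrightarrow> odd (coeff f d)" "d > 1 \<Longrightarrow> odd d \<Longrightarrow> even (coeff f d)"
    using mem[of d] by (auto simp: parity_set_def arb_first_def split: if_splits)
  show "even (coeff (pderiv f) i)" if "i > 0" for i
  proof (cases "odd (Suc i) \<and> Suc i \<le> d")
    case True
    then show ?thesis using mem[of "Suc i"] that by (simp add: coeff_pderiv parity_set_def arb_first_def split: if_splits)
  next
    case False
    then have "even (Suc i) \<or> coeff f (Suc i) = 0" using deg by (auto intro: coeff_eq_0)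
    then show ?thesis by (auto simp: coeff_pderiv)
  qed
qed

theorem theorem1p4:
  fixes d s :: nat
    and \<nu> :: "int poly poly set \<Rightarrow> int poly poly measure"
  assumes "d > 0" and "s \<ge> 2"
    and "\<And>B S. S \<in> quad_sets d s B \<Longrightarrow> strictly_positive_prob S (\<nu> S)"
  shows
    "(even d \<longrightarrow>
        liminf (\<lambda>B. ereal (real (card {S \<in> quad_sets d s B. measure (seq_measure (\<nu> S)) (BigArb S) > 0})
                           / real (card (quad_sets d s B))))
        \<ge> ereal (1 - (1 - r_dens d) ^ s)) \<and>
     (odd d \<longrightarrow>
        liminf (\<lambda>B. ereal (real (card {S \<in> quad_sets d s B. measure (seq_measure (\<nu> S)) (BigArb S) > 0})
                           / real (card (quad_sets d s B))))
        \<ge> ereal (1 - (1 - r_dens d) ^ s - (1/2) ^ s + (1 - r_dens d - 1/2) ^ s))"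
proof -
  define Q where "Q S \<longleftrightarrow> measure (seq_measure (\<nu> S)) (BigArb S) > 0" for S
  \<comment> \<open>\<open>A\<close> holds the candidates for the first constant, \<open>A'\<close>
    those whose coefficient at \<open>t^d\<close> is odd, which produce maximal steps.\<close>
  define A where "A = parity_box d (arb_first d)"
  define A' where "A' = parity_box d (\<lambda>i. if i = d then Some True else None)"
  have Q: "Q (quad ` C)"
    if C: "C \<subseteq> bounded_polys d B" "card C = s" "a \<in> C" "a \<in> A B" "b \<in> C" "odd (coeff b d)" for B C a b
  proof -
    have "quad ` C \<in> quad_sets d s B" using C by (auto simp: quad_sets_def)
    then have pos: "strictly_positive_prob (quad ` C) (\<nu> (quad ` C))" by (rule assms(3))
    have fin: "finite C" using C(1) finite_bounded_polys by (rule finite_subset)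
    have deg: "degree c \<le> d" if "c \<in> C" for c using that C(1) by (auto simp: bounded_polys_def)
    note a = parity_box_arb_first(1,2)[OF C(4)[unfolded A_def] assms(1)]
    show ?thesis
      unfolding Q_def by (rule measure_BigArb_pos[OF pos fin refl deg assms(1) C(3) a C(5,6)])
  qed
  have sub: "A B \<subseteq> bounded_polys d B" "A' B \<subseteq> bounded_polys d B" for B
    unfolding A_def A'_def by (rule parity_box_subset)+
  have limA: "(\<lambda>B. real (card (A B)) / real (card (bounded_polys d B))) \<longlonglongrightarrow> r_dens d"
    unfolding A_def r_dens_eq[OF assms(1)] by (rule parity_box_density)
  have A'_odd: "odd (coeff b d)" if "b \<in> A' B" for b B
    using that by (auto simp: A'_def parity_box_def coeff_box_def parity_set_def dest!: spec[of _ d])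
  have "{i. i \<le> d \<and> (if i = d then Some True else None) \<noteq> None} = {d}" by auto
  then have limA': "(\<lambda>B. real (card (A' B)) / real (card (bounded_polys d B))) \<longlonglongrightarrow> 1 / 2"
    using parity_box_density[of d "\<lambda>i. if i = d then Some True else None"] by (simp add: A'_def)
  \<comment> \<open>For even \<open>d\<close> the top coefficient is prescribed odd; for
    \<open>d = 1\<close> it is the coefficient of t. In both cases one element plays both
    roles.\<close>
  have meet_A: "Q (quad ` C)"
    if C: "C \<subseteq> bounded_polys d B" "card C = s" "C \<inter> A B \<noteq> {}" "even d \<or> d = 1" for B C
  proof -
    obtain a where a: "a \<in> C" "a \<in> A B" using C(3) by blast
    have "odd (coeff a d)"
      using parity_box_arb_first(1,3)[of a d B] a C(4) assms(1) by (auto simp: A_def coeff_pderiv)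
    then show ?thesis using Q C a by blast
  qed
  have meet_both: "Q (quad ` C)"
    if "C \<subseteq> bounded_polys d B" "card C = s" "C \<inter> A B \<noteq> {}" "C \<inter> A' B \<noteq> {}" for B C
    using that Q A'_odd by blast
  have one_type: "ereal (1 - (1 - r_dens d) ^ s) \<le>
      liminf (\<lambda>B. ereal (real (card {S \<in> quad_sets d s B. Q S}) / real (card (quad_sets d s B))))"
    if "even d \<or> d = 1"
    using liminf_proportion_ge[of A d A "r_dens d" "r_dens d" "r_dens d" s Q] sub(1) limA meet_A that by simp
  have two_types: "ereal (1 - (1 - r_dens d) ^ s - (1/2) ^ s + (1 - r_dens d - 1/2) ^ s) \<le>
      liminf (\<lambda>B. ereal (real (card {S \<in> quad_sets d s B. Q S}) / real (card (quad_sets d s B))))"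
    if "odd d"
  proof (cases "d = 1")
    case True
    \<comment> \<open>Here \<open>r_dens d = 1 / 2\<close>, so the last summand is
      \<open>0 ^ s = 0\<close> and the claim is weaker than the bound for one kind. The two classes
      coincide, so the disjoint count would not apply.\<close>
    have "1 - (1 - r_dens d) ^ s - (1/2) ^ s + (1 - r_dens d - 1/2) ^ s \<le> 1 - (1 - r_dens d) ^ s"
      using True assms(2) by (simp add: r_dens_def)
    then have "ereal (1 - (1 - r_dens d) ^ s - (1/2) ^ s + (1 - r_dens d - 1/2) ^ s) \<le> ereal (1 - (1 - r_dens d) ^ s)"
      by simp
    then show ?thesis by (rule order.trans) (rule one_type, simp add: True)
  next
    case False
    then have "d > 1" using assms(1) by simp
    then have disj: "A B \<inter> A' B = {}" for B
      using parity_box_arb_first(4)[of _ d B] A'_odd[of _ B] that unfolding A_def by auto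
    have "card (A B \<union> A' B) = card (A B) + card (A' B)" for B
      by (rule card_Un_disjoint[OF finite_subset[OF sub(1) finite_bounded_polys]
            finite_subset[OF sub(2) finite_bounded_polys] disj])
    then have limU: "(\<lambda>B. real (card (A B \<union> A' B)) / real (card (bounded_polys d B))) \<longlonglongrightarrow> r_dens d + 1 / 2"
      using tendsto_add[OF limA limA'] by (simp add: add_divide_distrib)
    have eq: "1 - (r_dens d + 1 / 2) = 1 - r_dens d - 1 / 2" "1 - 1 / 2 = (1 / 2 :: real)" by simp_all
    show ?thesis
      by (rule liminf_proportion_ge[of A d A' "r_dens d" "1 / 2" "r_dens d + 1 / 2" s Q,
            OF sub limA limA' limU, unfolded eq]) (rule meet_both)
  qed
  show ?thesis using one_type two_types by (simp add: Q_def)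
qed

end
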